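(* Let $\Omega=(a_1,b_1)\times\cdots\times(a_n,b_n)\subset\mathbb{R}^n$, $n\ge2$, be a bounded box with admissible mesh size vector $h$. Assume $1\le p<\frac{n+2}{n-2}$ if $n\ge3$ and $1\le p<\infty$ if $n=2$. For $n\ge3$ let $q=\frac{2n}{(n-2)(p-1)}$; for $n=2$ choose $q>\max\{1,\frac{2}{p-1}\}$ and $\hat n$ with $q>\frac{\hat n}{2}>1$; let $q'=\frac{q}{q-1}$. Let $f:\Omega_h\times\mathbb{R}\to\mathbb{R}$ satisfy $|f(x,s)|\le C_2|s|^p+C_3$ for all $s\in\mathbb{R}$, $x\in\Omega_h$, with constants $C_2,C_3>0$, and let $u\in W_0^{1,2}(\overline{\Omega}_h)$ solve $$-\Delta_hu=f(x,u)\ \text{in }\Omega_h,\qquad u=0\ \text{on }\partial\Omega_h.$$ Then $$\|u\|_\infty\le(2K_u)^{q'}C_P(\Omega)\|u\|_D+2K_uC_3(1+|\Omega|),$$ where for $n\ge3$ $$K_u=\max\Big\{\frac{n}{(n-2)q'},\ C_S(n)\sqrt2\sqrt{C_2C_S(n)^{p-1}\|u\|_D^{p-1}+|\Omega|^{1/q}}\Big\}^{\left(\frac{n(q-1)}{2q-n}\right)^2}$$ and for $n=2$ $$K_u=\max\Big\{\frac{\hat n}{(\hat n-2)q'},\ \frac{4\hat n}{\hat n-2}\big(2C_S(2)(1+C_P(\Omega))q(p-1)\big)^{\frac{p+1}{2}}\sqrt{C_2\|u\|_D^{p-1}+|\Omega|^{1/q}}\Big\}^{\left(\frac{\hat n(q-1)}{2q-\hat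 n}\right)^2}.$$
   Context: Admissible mesh: $h_i>0$, $a_i=k_ih_i$, $b_i=l_ih_i$, $k_i,l_i\in\mathbb{Z}$, $l_i-k_i>1$; $\mathbb{R}^n_h=\{(h_1z_1,\dots,h_nz_n):z_i\in\mathbb{Z}\}$, $\overline{\Omega}_h=\overline{\Omega}\cap\mathbb{R}^n_h$, $\Omega_h=\Omega\cap\mathbb{R}^n_h$, $\partial\Omega_h=\partial\Omega\cap\mathbb{R}^n_h$, $\partial_i^+\Omega_h=\partial\Omega_h\cap\{x_i=b_i\}$, $\mathbf{h}=h_1\cdots h_n$, $|\Omega|=\prod_i(b_i-a_i)$. $\Delta_hu(x)=\sum_i\frac{u(x+h_ie_i)-2u(x)+u(x-h_ie_i)}{h_i^2}$, $D_i^+u(x)=(u(x+h_ie_i)-u(x))/h_i$, $\|u\|_D^2=\sum_i\sum_{x\in\overline{\Omega}_h\setminus\partial_i^+\Omega_h}|D_i^+u(x)|^2\mathbf{h}$, $\|u\|_{L^2}^2=\sum_{x\in\overline{\Omega}_h}|u|^2\mathbf{h}$, $\|u\|_\infty=\max|u|$. $W_0^{1,2}(\overline{\Omega}_h)$ = functions on $\overline{\Omega}_h$ vanishing on $\partial\Omega_h$. Constants: $C_S(n)=\frac{4(n-1)}{\sqrt n(n-2)}$ ($n\ge3$), $C_S(2)=8\sqrt{2\pi(e+256)}$; $C_P(\Omega)$ is a Poincaré constant, i.e. $\|v\|_{L^2}\le C_P(\Omega)\|v\|_D$ for all $v\in W_0^{1,2}(\overline{\Omega}_h)$.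
   Formalization: At p=1, where 2/(p-1) and 2n/((n-2)(p-1)) are undefined: for n≥3 the limiting values are used (q'=1, 1/q=0, n(q-1)/(2q-n)=n/2, zeroth powers equal to 1); for n=2 the condition on q is read as q(p-1)>2, which excludes p=1. *)

theory Defs
  imports "HOL-Analysis.Analysis"
begin

text \<open>x + h_i e_i is written x(i := x i + h i). Points of R^n are modelled as functions x :: nat => real with x i = 0 for i >= n.
  The box data: a, b (endpoints), h (mesh sizes), all indexed by i < n.\<close>

definition grid :: "nat \<Rightarrow> (nat \<Rightarrow> real) \<Rightarrow> (nat \<Rightarrow> real) set" where
  "grid n h = {x. (\<forall>i<n. \<exists>z::int. x i = h i * of_int z) \<and> (\<forall>i\<ge>n. x i = 0)}"

definition closed_box :: "nat \<Rightarrow> (nat \<Rightarrow> real) \<Rightarrow> (nat \<Rightarrow> real) \<Rightarrow> (nat \<Rightarrow> real) set" where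
  "closed_box n a b = {x. (\<forall>i<n. a i \<le> x i \<and> x i \<le> b i) \<and> (\<forall>i\<ge>n. x i = 0)}"

definition open_box :: "nat \<Rightarrow> (nat \<Rightarrow> real) \<Rightarrow> (nat \<Rightarrow> real) \<Rightarrow> (nat \<Rightarrow> real) set" where
  "open_box n a b = {x. (\<forall>i<n. a i < x i \<and> x i < b i) \<and> (\<forall>i\<ge>n. x i = 0)}"

definition OmegaBar_h where "OmegaBar_h n a b h = closed_box n a b \<inter> grid n h"
definition Omega_h where "Omega_h n a b h = open_box n a b \<inter> grid n h"
definition dOmega_h where "dOmega_h n a b h = (closed_box n a b - open_box n a b) \<inter> grid n h"
definition dOmega_plus_h where "dOmega_plus_h n a b h i = dOmega_h n a b h \<inter> {x. x i = b i}"

definition admissible_mesh :: "nat \<Rightarrow> (nat \<Rightarrow> real) \<Rightarrow> (nat \<Rightarrow> real) \<Rightarrow> (nat \<Rightarrow> real) \<Rightarrow> bool" where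
  "admissible_mesh n a b h \<longleftrightarrow> (\<forall>i<n. h i > 0 \<and> (\<exists>k l :: int. a i = of_int k * h i \<and> b i = of_int l * h i \<and> l - k > 1))"

definition hprod where "hprod n h = (\<Prod>i<n. h i)"
definition box_vol where "box_vol n a b = (\<Prod>i<n. b i - a i)"

definition lap_h :: "nat \<Rightarrow> (nat \<Rightarrow> real) \<Rightarrow> ((nat \<Rightarrow> real) \<Rightarrow> real) \<Rightarrow> (nat \<Rightarrow> real) \<Rightarrow> real" where
  "lap_h n h u x = (\<Sum>i<n. (u (x(i := x i + h i)) - 2 * u x + u (x(i := x i - h i))) / (h i)\<^sup>2)"

definition Dplus :: "(nat \<Rightarrow> real) \<Rightarrow> nat \<Rightarrow> ((nat \<Rightarrow> real) \<Rightarrow> real) \<Rightarrow> (nat \<Rightarrow> real) \<Rightarrow> real" where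
  "Dplus h i u x = (u (x(i := x i + h i)) - u x) / h i"

definition normD where
  "normD n a b h u = sqrt (\<Sum>i<n. \<Sum>x\<in>OmegaBar_h n a b h - dOmega_plus_h n a b h i. (Dplus h i u x)\<^sup>2 * hprod n h)"

definition normL2 where
  "normL2 n a b h u = sqrt (\<Sum>x\<in>OmegaBar_h n a b h. (u x)\<^sup>2 * hprod n h)"

definition normInf where
  "normInf n a b h u = Max ((\<lambda>x. \<bar>u x\<bar>) ` OmegaBar_h n a b h)"

definition W0 where "W0 n a b h = {u. \<forall>x\<in>dOmega_h n a b h. u x = 0}"

definition C_S :: "nat \<Rightarrow> real" where
  "C_S n = (if n = 2 then 8 * sqrt (2 * pi * (exp 1 + 256))
            else 4 * (real n - 1) / (sqrt (real n) * (real n - 2)))"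

text \<open>Exponents for n >= 3: q = 2n/((n-2)(p-1)); for p = 1 we use the limiting
  values q = infinity, i.e. q' = 1, 1/q = 0, n(q-1)/(2q-n) = n/2, and ||u||^(p-1) = 1.\<close>
definition q3 :: "nat \<Rightarrow> real \<Rightarrow> real" where
  "q3 n p = 2 * real n / ((real n - 2) * (p - 1))"

definition q3' :: "nat \<Rightarrow> real \<Rightarrow> real" where
  "q3' n p = (if p = 1 then 1 else q3 n p / (q3 n p - 1))"

definition inv_q3 :: "nat \<Rightarrow> real \<Rightarrow> real" where
  "inv_q3 n p = (if p = 1 then 0 else 1 / q3 n p)"

definition expo3 :: "nat \<Rightarrow> real \<Rightarrow> real" where
  "expo3 n p = (if p = 1 then real n / 2
                else real n * (q3 n p - 1) / (2 * q3 n p - real n))"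

definition pow0 :: "real \<Rightarrow> real \<Rightarrow> real" where
  "pow0 x e = (if e = 0 then 1 else x powr e)"

definition K3 :: "nat \<Rightarrow> real \<Rightarrow> real \<Rightarrow> real \<Rightarrow> real \<Rightarrow> real" where
  "K3 n p C2 D vol =
     (max (real n / ((real n - 2) * q3' n p))
          (C_S n * sqrt 2 * sqrt (C2 * pow0 (C_S n) (p - 1) * pow0 D (p - 1) + vol powr inv_q3 n p)))
     powr ((expo3 n p)\<^sup>2)"

definition K2 :: "real \<Rightarrow> real \<Rightarrow> real \<Rightarrow> real \<Rightarrow> real \<Rightarrow> real \<Rightarrow> real \<Rightarrow> real" where
  "K2 q nh p C2 CP D vol =
     (let q' = q / (q - 1) in
     (max (nh / ((nh - 2) * q'))
          (4 * nh / (nh - 2) * (2 * C_S 2 * (1 + CP) * q * (p - 1)) powr ((p + 1) / 2)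
             * sqrt (C2 * D powr (p - 1) + vol powr (1 / q))))
     powr ((nh * (q - 1) / (2 * q - nh))\<^sup>2))"

end

theory Submission
  imports Defs
begin

text \<open>
  Put \<open>k = C\<^sub>3 (1 + \<bar>\<Omega>\<bar>)\<close>, \<open>1/q' = 1 - 1/q\<close> and let \<open>\<tau>\<close> be the Sobolev exponent. Testing the equation with
  \<open>u \<bar>u\<bar>\<^bsup>2\<beta>-2\<^esup>\<close> and applying the Sobolev inequality to \<open>\<bar>u\<bar>\<^bsup>\<beta>\<^esup>\<close> bounds the \<open>L\<^bsup>\<tau>\<beta>\<^esup>\<close> norm of \<open>u\<close> by
  \<open>(C \<beta>)\<^bsup>1/\<beta>\<^esup>\<close> times the maximum of its \<open>L\<^bsup>2q'\<beta>\<^esup>\<close> norm and \<open>k\<close>. Using the maximum instead of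
  \<open>\<bar>u\<bar> + k\<close> keeps the zero boundary values. Moser iteration along \<open>\<beta> = \<rho>\<^bsup>m\<^esup>\<close>, \<open>\<rho> = \<tau>/(2q')\<close>, produces the
  factor \<open>K = max(\<rho>, C)\<^bsup>\<Sum>(m+1)/\<rho>^m\<^esup>\<close> with exponent \<open>(\<rho>/(\<rho>-1))\<^sup>2\<close>; interpolating \<open>L\<^bsup>2q'\<^esup>\<close> between \<open>L\<^sup>2\<close> and
  \<open>L\<^bsup>\<infinity>\<^esup>\<close> and absorbing the \<open>L\<^bsup>\<infinity>\<^esup>\<close> norm gives the bound. The Sobolev inequalities follow from the
  discrete Loomis--Whitney inequality, in dimension 2 by iterating over the even exponents.
\<close>

section \<open>The Loomis--Whitney inequality for finite sums\<close>

text \<open>Divide each factor by its total and apply the arithmetic-geometric mean inequality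
  pointwise; summed over \<open>t\<close>, the normalised means add up to 1. A factor with total 0
  cannot be normalised, but it vanishes identically on \<open>T\<close>.\<close>

lemma holder_sum_prod:
  fixes a :: "'j \<Rightarrow> 't \<Rightarrow> real"
  assumes J: "finite J" "J \<noteq> {}" and T: "finite T"
    and nn: "\<And>j t. j \<in> J \<Longrightarrow> t \<in> T \<Longrightarrow> 0 \<le> a j t"
  shows "(\<Sum>t\<in>T. (\<Prod>j\<in>J. a j t) powr (1 / card J)) \<le> (\<Prod>j\<in>J. \<Sum>t\<in>T. a j t) powr (1 / card J)"
proof (cases "\<exists>j\<in>J. (\<Sum>t\<in>T. a j t) = 0")
  case True
  then obtain j where j: "j \<in> J" "\<And>t. t \<in> T \<Longrightarrow> a j t = 0"
    using nn T by (metis sum_nonneg_eq_0_iff)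
  then have "(\<Prod>j\<in>J. a j t) = 0" if "t \<in> T" for t
    using that J(1) by (auto intro: prod_zero)
  then show ?thesis by simp
next
  case False
  define s where "s j = (\<Sum>t\<in>T. a j t)" for j
  have s: "s j > 0" if "j \<in> J" for j
    using that False nn by (auto simp: s_def less_le intro!: sum_nonneg)
  have P: "(\<Prod>j\<in>J. s j) > 0" using s by (intro prod_pos) auto
  have "(\<Prod>j\<in>J. a j t) powr (1 / card J) \<le> (\<Prod>j\<in>J. s j) powr (1 / card J) * (\<Sum>j\<in>J. a j t / s j / card J)"
    if t: "t \<in> T" for t
  proof -
    have "(\<Prod>j\<in>J. a j t) = (\<Prod>j\<in>J. s j) * (\<Prod>j\<in>J. a j t / s j)"
      using P by (simp add: prod_dividef)
    then have "(\<Prod>j\<in>J. a j t) powr (1 / card J)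
        = (\<Prod>j\<in>J. s j) powr (1 / card J) * (\<Prod>j\<in>J. a j t / s j) powr (1 / card J)"
      by (simp add: powr_mult)
    also have "\<dots> \<le> (\<Prod>j\<in>J. s j) powr (1 / card J) * (\<Sum>j\<in>J. a j t / s j / card J)"
      using J s nn t by (intro mult_left_mono arith_geom_mean) (auto simp: less_imp_le)
    finally show ?thesis .
  qed
  then have "(\<Sum>t\<in>T. (\<Prod>j\<in>J. a j t) powr (1 / card J))
      \<le> (\<Sum>t\<in>T. (\<Prod>j\<in>J. s j) powr (1 / card J) * (\<Sum>j\<in>J. a j t / s j / card J))"
    by (rule sum_mono)
  also have "\<dots> = (\<Prod>j\<in>J. s j) powr (1 / card J) * (\<Sum>j\<in>J. \<Sum>t\<in>T. a j t / s j / card J)"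
    by (subst sum.swap) (simp add: sum_distrib_left)
  also have "(\<Sum>j\<in>J. \<Sum>t\<in>T. a j t / s j / card J) = (\<Sum>j\<in>J. s j / s j / card J)"
    by (simp only: s_def sum_divide_distrib)
  also have "\<dots> = (\<Sum>j\<in>J. 1 / card J)"
    using s by (intro sum.cong) (force dest: less_imp_neq)+
  also have "\<dots> = 1"
    using J by simp
  finally show ?thesis by (simp add: s_def)
qed

text \<open>The same normalisation, with Young's inequality for the weights \<theta> and 1 -
  \<theta> in place of the arithmetic-geometric mean inequality.\<close>

lemma holder_sum:
  fixes a b :: "'t \<Rightarrow> real"
  assumes \<theta>: "0 < \<theta>" "\<theta> < 1" and T: "finite T"
    and nn: "\<And>t. t \<in> T \<Longrightarrow> 0 \<le> a t" "\<And>t. t \<in> T \<Longrightarrow> 0 \<le> b t"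
  shows "(\<Sum>t\<in>T. a t powr \<theta> * b t powr (1 - \<theta>)) \<le> (\<Sum>t\<in>T. a t) powr \<theta> * (\<Sum>t\<in>T. b t) powr (1 - \<theta>)"
proof (cases "(\<Sum>t\<in>T. a t) = 0 \<or> (\<Sum>t\<in>T. b t) = 0")
  case True
  then have "\<forall>t\<in>T. a t powr \<theta> * b t powr (1 - \<theta>) = 0"
    using nn T by (auto simp: sum_nonneg_eq_0_iff)
  then have "(\<Sum>t\<in>T. a t powr \<theta> * b t powr (1 - \<theta>)) = 0"
    by (intro sum.neutral)
  then show ?thesis by simp
next
  case False
  define A B where "A = (\<Sum>t\<in>T. a t)" and "B = (\<Sum>t\<in>T. b t)"
  have AB: "A > 0" "B > 0"
    using False nn by (auto simp: A_def B_def less_le intro!: sum_nonneg)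
  have "a t powr \<theta> * b t powr (1 - \<theta>)
      \<le> A powr \<theta> * B powr (1 - \<theta>) * (\<theta> * (a t / A) + (1 - \<theta>) * (b t / B))" if t: "t \<in> T" for t
  proof (cases "a t = 0 \<or> b t = 0")
    case True
    then show ?thesis using nn[OF t] \<theta> AB by auto
  next
    case False
    then have "(a t / A) powr \<theta> * (b t / B) powr (1 - \<theta>) \<le> \<theta> * (a t / A) + (1 - \<theta>) * (b t / B)"
      using \<theta> AB nn[OF t] by (intro Youngs_inequality_0) auto
    then show ?thesis
      using AB by (simp add: powr_divide field_simps)
  qed
  then have "(\<Sum>t\<in>T. a t powr \<theta> * b t powr (1 - \<theta>))
      \<le> (\<Sum>t\<in>T. A powr \<theta> * B powr (1 - \<theta>) * (\<theta> * (a t / A) + (1 - \<theta>) * (b t / B)))"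
    by (rule sum_mono)
  also have "\<dots> = A powr \<theta> * B powr (1 - \<theta>) * (\<theta> * (A / A) + (1 - \<theta>) * (B / B))"
    by (simp add: sum_distrib_left[symmetric] sum.distrib A_def B_def sum_divide_distrib[symmetric])
  also have "\<dots> = A powr \<theta> * B powr (1 - \<theta>)"
    using AB by simp
  finally show ?thesis by (simp add: A_def B_def)
qed

section \<open>Iterated coordinate sums and the Loomis--Whitney induction\<close>

text \<open>Summing one coordinate at a time turns Loomis--Whitney into an induction on
  \<open>m\<close>. An index \<open>j \<ge> m\<close> skips no coordinate, so \<open>j = n\<close>
  encodes the full sum.\<close>

fun slice_sum :: "(nat \<Rightarrow> 'b set) \<Rightarrow> nat \<Rightarrow> nat \<Rightarrow> ((nat \<Rightarrow> 'b) \<Rightarrow> real) \<Rightarrow> (nat \<Rightarrow> 'b) \<Rightarrow> real" where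
  "slice_sum A j 0 g x = g x"
| "slice_sum A j (Suc m) g x =
     (if m = j then slice_sum A j m g x else \<Sum>t\<in>A m. slice_sum A j m g (x(m := t)))"

lemma slice_sum_nonneg:
  "(\<And>x. 0 \<le> g x) \<Longrightarrow> 0 \<le> slice_sum A j m g x"
  by (induction m arbitrary: x) (auto intro!: sum_nonneg)

lemma slice_sum_independent:
  assumes "\<And>x t. g (x(j := t)) = g x" and "m \<le> j"
  shows "slice_sum A i m g (x(j := t)) = slice_sum A i m g x"
  using assms(2)
proof (induction m arbitrary: x)
  case (Suc m)
  have "slice_sum A i m g (x(j := t, m := s)) = slice_sum A i m g (x(m := s))" for s
    using Suc.prems Suc.IH[of "x(m := s)"] fun_upd_twist[of j m x t s] by (simp del: fun_upd_apply)
  then show ?case using Suc.prems Suc.IH[of x] by (auto simp del: fun_upd_apply)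
qed (simp add: assms)

text \<open>Induction on the number of summed coordinates. When coordinate \<open>m\<close> is
  summed, the factor \<open>g m\<close> does not depend on it and comes out of the sum; Hoelder
  handles the other n - 1 factors.\<close>

lemma loomis_whitney_slice:
  assumes n: "2 \<le> n" and A: "\<And>i. finite (A i)"
    and g0: "\<And>j x. 0 \<le> g j x"
    and gj: "\<And>j x t. j < n \<Longrightarrow> g j (x(j := t)) = g j x"
    and "m \<le> n"
  shows "slice_sum A n m (\<lambda>x. (\<Prod>j<n. g j x) powr (1 / (real n - 1))) x
      \<le> (\<Prod>j<n. slice_sum A j m (g j) x) powr (1 / (real n - 1))"
  using \<open>m \<le> n\<close>
proof (induction m arbitrary: x)
  case (Suc m)
  let ?e = "1 / (real n - 1)" and ?J = "{..<n} - {m}"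
  have J: "finite ?J" "real (card ?J) = real n - 1" "?J \<noteq> {}"
  proof -
    show "finite ?J" by simp
    have "card ?J = n - 1" using Suc.prems by simp
    then show "real (card ?J) = real n - 1" "?J \<noteq> {}"
      using n by (fastforce simp: of_nat_diff dest: arg_cong[where f = card])+
  qed
  define c where "c = slice_sum A m m (g m) x"
  have c: "slice_sum A m m (g m) (x(m := t)) = c" for t
    unfolding c_def using Suc.prems by (intro slice_sum_independent gj) auto
  have split: "(\<Prod>j<n. F j) = F m * (\<Prod>j\<in>?J. F j)" for F :: "nat \<Rightarrow> real"
    using Suc.prems by (intro prod.remove) auto
  have c0: "0 \<le> c" unfolding c_def by (rule slice_sum_nonneg) (rule g0)
  have "slice_sum A n (Suc m) (\<lambda>x. (\<Prod>j<n. g j x) powr ?e) x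
      = (\<Sum>t\<in>A m. slice_sum A n m (\<lambda>x. (\<Prod>j<n. g j x) powr ?e) (x(m := t)))"
    using Suc.prems by simp
  also have "\<dots> \<le> (\<Sum>t\<in>A m. (\<Prod>j<n. slice_sum A j m (g j) (x(m := t))) powr ?e)"
    using Suc by (intro sum_mono) simp
  also have "\<dots> = c powr ?e * (\<Sum>t\<in>A m. (\<Prod>j\<in>?J. slice_sum A j m (g j) (x(m := t))) powr ?e)"
    by (simp add: split c powr_mult sum_distrib_left)
  \<comment> \<open>Exactly n - 1 factors still depend on \<open>t\<close>, which is why the
    exponent 1/(n - 1) is the right one for Hoelder with equal weights.\<close>
  also have "\<dots> \<le> c powr ?e * (\<Prod>j\<in>?J. \<Sum>t\<in>A m. slice_sum A j m (g j) (x(m := t))) powr ?e"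
    using J holder_sum_prod[of ?J "A m" "\<lambda>j t. slice_sum A j m (g j) (x(m := t))"] A
    by (intro mult_left_mono) (auto intro: slice_sum_nonneg g0)
  also have "\<dots> = (\<Prod>j<n. slice_sum A j (Suc m) (g j) x) powr ?e"
    by (auto simp: split c_def powr_mult intro!: arg_cong2[where f="(*)"] arg_cong[where f="\<lambda>z. z powr _"] prod.cong)
  finally show ?case .
qed simp

text \<open>Fubini: the fibre sum in direction \<open>j\<close> supplies the one summation that the
  slice sum skips.\<close>

lemma slice_sum_fiber:
  assumes "j < m" and "m \<le> n"
  shows "slice_sum A j m (\<lambda>x. \<Sum>t\<in>A j. G (x(j := t))) x = slice_sum A n m G x"
proof -
  \<comment> \<open>While only coordinates below \<open>j\<close> are summed nothing has been
    skipped yet, so the fibre sum just moves outside.\<close>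
  have before: "slice_sum A j k (\<lambda>x. \<Sum>t\<in>A j. G (x(j := t))) x = (\<Sum>t\<in>A j. slice_sum A n k G (x(j := t)))"
    if "k \<le> j" "j < n" for k x
    using that
  proof (induction k arbitrary: x)
    case (Suc k)
    have "slice_sum A j (Suc k) (\<lambda>x. \<Sum>t\<in>A j. G (x(j := t))) x
       = (\<Sum>s\<in>A k. \<Sum>t\<in>A j. slice_sum A n k G (x(k := s, j := t)))"
      using Suc.prems by (simp add: Suc.IH del: fun_upd_apply)
    also have "\<dots> = (\<Sum>t\<in>A j. \<Sum>s\<in>A k. slice_sum A n k G (x(j := t, k := s)))"
      using Suc.prems fun_upd_twist[of j k x] by (subst sum.swap) (simp del: fun_upd_apply)
    finally show ?case using Suc.prems by (simp del: fun_upd_apply)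
  qed simp
  show ?thesis
    using assms
  proof (induction m arbitrary: x)
    case (Suc m)
    show ?case
    proof (cases "m = j")
      case True
      then show ?thesis using before[of j x] Suc.prems by (simp del: fun_upd_apply)
    next
      case False
      then show ?thesis using Suc by (simp del: fun_upd_apply)
    qed
  qed simp
qed

text \<open>The product set is the disjoint union of its slices at a fixed value of the last
  coordinate. Finiteness and the sum formula are proved in one induction because the union formula
  needs finite slices.\<close>

lemma slice_sum_eq_sum:
  assumes A: "\<And>i. finite (A i)" and "m \<le> n"
  shows "finite {y. (\<forall>i<m. y i \<in> A i) \<and> (\<forall>i\<ge>m. y i = x i)}"
    "slice_sum A n m F x = (\<Sum>y\<in>{y. (\<forall>i<m. y i \<in> A i) \<and> (\<forall>i\<ge>m. y i = x i)}. F y)"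
proof -
  let ?P = "\<lambda>m x. {y. (\<forall>i<m. y i \<in> A i) \<and> (\<forall>i\<ge>m. y i = x i)}"
  have "finite (?P m x) \<and> slice_sum A n m F x = sum F (?P m x)"
    using \<open>m \<le> n\<close>
  proof (induction m arbitrary: x)
    case 0
    have "?P 0 x = {x}" by auto
    then show ?case by simp
  next
    case (Suc m)
    have U: "?P (Suc m) x = (\<Union>t\<in>A m. ?P m (x(m := t)))"
    proof (intro set_eqI iffI)
      fix y assume "y \<in> ?P (Suc m) x"
      then show "y \<in> (\<Union>t\<in>A m. ?P m (x(m := t)))"
        by (intro UN_I[of "y m"]) auto
    next
      fix y assume "y \<in> (\<Union>t\<in>A m. ?P m (x(m := t)))"
      then obtain t where t: "t \<in> A m" "\<forall>i<m. y i \<in> A i" "\<forall>i\<ge>m. y i = (x(m := t)) i" by auto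
      have "y i \<in> A i" if "i < Suc m" for i
        using t that by (cases "i = m") auto
      then show "y \<in> ?P (Suc m) x" using t by auto
    qed
    have disj: "?P m (x(m := s)) \<inter> ?P m (x(m := t)) = {}" if "s \<noteq> t" for s t
    proof -
      have "y m = s \<and> y m = t" if "y \<in> ?P m (x(m := s)) \<inter> ?P m (x(m := t))" for y
        using that by auto
      then show ?thesis using \<open>s \<noteq> t\<close> by blast
    qed
    have "sum F (?P (Suc m) x) = (\<Sum>t\<in>A m. sum F (?P m (x(m := t))))"
      unfolding U using A Suc disj by (intro sum.UNION_disjoint) auto
    then show ?case using Suc A U by auto
  qed
  then show "finite {y. (\<forall>i<m. y i \<in> A i) \<and> (\<forall>i\<ge>m. y i = x i)}"
    "slice_sum A n m F x = (\<Sum>y\<in>{y. (\<forall>i<m. y i \<in> A i) \<and> (\<forall>i\<ge>m. y i = x i)}. F y)" by auto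
qed

text \<open>Multiplying the \<open>n\<close> line bounds gives \<open>\<bar>w x\<bar> ^ n\<close>
  below a product whose j-th factor does not depend on coordinate \<open>j\<close>; the root of
  order n - 1 is then summed by Loomis--Whitney.\<close>

lemma gagliardo_nirenberg_sum:
  fixes d :: "nat \<Rightarrow> (nat \<Rightarrow> 'b) \<Rightarrow> real"
  assumes n: "2 \<le> n" and A: "\<And>i. finite (A i)"
    and B: "B = {y. (\<forall>i<n. y i \<in> A i) \<and> (\<forall>i\<ge>n. y i = z i)}"
    and d0: "\<And>i x. 0 \<le> d i x"
    and line: "\<And>i x. i < n \<Longrightarrow> x \<in> B \<Longrightarrow> \<bar>w x\<bar> \<le> (\<Sum>t\<in>A i. d i (x(i := t)))"
  shows "(\<Sum>x\<in>B. \<bar>w x\<bar> powr (real n / (real n - 1))) \<le> (\<Prod>i<n. \<Sum>x\<in>B. d i x) powr (1 / (real n - 1))"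
proof -
  let ?e = "1 / (real n - 1)"
  let ?g = "\<lambda>j x. \<Sum>t\<in>A j. d j (x(j := t))"
  have "\<bar>w x\<bar> powr (real n / (real n - 1)) \<le> (\<Prod>j<n. ?g j x) powr ?e" if x: "x \<in> B" for x
  proof -
    have "\<bar>w x\<bar> ^ n = (\<Prod>j<n. \<bar>w x\<bar>)" by simp
    also have "\<dots> \<le> (\<Prod>j<n. ?g j x)"
      using line x by (intro prod_mono) auto
    finally have "(\<bar>w x\<bar> ^ n) powr ?e \<le> (\<Prod>j<n. ?g j x) powr ?e"
      using n by (intro powr_mono2) auto
    moreover have "(\<bar>w x\<bar> ^ n) powr ?e = \<bar>w x\<bar> powr (real n / (real n - 1))"
      using n by (cases "w x = 0") (auto simp: powr_realpow[symmetric] powr_powr)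
    ultimately show ?thesis by simp
  qed
  then have "(\<Sum>x\<in>B. \<bar>w x\<bar> powr (real n / (real n - 1))) \<le> (\<Sum>x\<in>B. (\<Prod>j<n. ?g j x) powr ?e)"
    by (rule sum_mono)
  also have "\<dots> = slice_sum A n n (\<lambda>x. (\<Prod>j<n. ?g j x) powr ?e) z"
    unfolding B using slice_sum_eq_sum(2)[where A=A, OF A order_refl] by simp
  also have "\<dots> \<le> (\<Prod>j<n. slice_sum A j n (?g j) z) powr ?e"
    using n A d0 by (intro loomis_whitney_slice) (auto intro: sum_nonneg)
  also have "(\<Prod>j<n. slice_sum A j n (?g j) z) = (\<Prod>j<n. slice_sum A n n (d j) z)"
    by (intro prod.cong refl slice_sum_fiber) auto
  also have "\<dots> = (\<Prod>i<n. \<Sum>x\<in>B. d i x)"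
    unfolding B using slice_sum_eq_sum(2)[where A=A, OF A order_refl] by simp
  finally show ?thesis .
qed

section \<open>Moser iteration\<close>

text \<open>Mean value theorem, with the derivative largest at the right endpoint. The case
  \<open>t = 0\<close> is separate because the derivative is only used at positive points.\<close>

lemma powr_diff_le:
  fixes s t \<beta> :: real
  assumes "0 \<le> t" "t \<le> s" "1 \<le> \<beta>"
  shows "s powr \<beta> - t powr \<beta> \<le> \<beta> * s powr (\<beta> - 1) * (s - t)"
proof (cases "t = 0 \<or> t = s")
  case True
  then show ?thesis
  proof
    assume "t = 0"
    have "s powr \<beta> = s powr (\<beta> - 1) * s"
      using assms by (cases "s = 0") (auto simp: powr_diff)
    moreover have "s powr (\<beta> - 1) * s \<le> \<beta> * (s powr (\<beta> - 1) * s)"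
      using assms mult_right_mono[of 1 \<beta> "s powr (\<beta> - 1) * s"] by simp
    ultimately show ?thesis using \<open>t = 0\<close> assms by (simp add: mult.assoc)
  qed simp
next
  case False
  then have st: "0 < t" "t < s" using assms by auto
  have "\<And>x. t \<le> x \<Longrightarrow> x \<le> s \<Longrightarrow> ((\<lambda>x. x powr \<beta>) has_real_derivative \<beta> * x powr (\<beta> - 1)) (at x)"
    using st by (intro has_real_derivative_powr) auto
  from MVT2[OF st(2) this] obtain z where z: "t < z" "z < s"
    "s powr \<beta> - t powr \<beta> = (s - t) * (\<beta> * z powr (\<beta> - 1))" by auto
  have "z powr (\<beta> - 1) \<le> s powr (\<beta> - 1)"
    using z st assms by (intro powr_mono2) auto
  then have "(s - t) * (\<beta> * z powr (\<beta> - 1)) \<le> (s - t) * (\<beta> * s powr (\<beta> - 1))"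
    using st assms by (intro mult_left_mono) auto
  then show ?thesis using z by (simp add: algebra_simps)
qed

text \<open>Stroock--Varopoulos inequality: the discrete counterpart of testing with \<open>u \<bar>u\<bar>\<^bsup>2\<beta>-2\<^esup>\<close>.\<close>
lemma stroock_varopoulos:
  fixes s t \<beta> :: real
  assumes \<beta>: "1 \<le> \<beta>"
  shows "(\<bar>s\<bar> powr \<beta> - \<bar>t\<bar> powr \<beta>)\<^sup>2
    \<le> \<beta> * ((s - t) * (sgn s * \<bar>s\<bar> powr (2 * \<beta> - 1) - sgn t * \<bar>t\<bar> powr (2 * \<beta> - 1)))"
proof -
  \<comment> \<open>Equal signs: one factor of the square is bounded by the slope at the larger
    endpoint \<open>x\<close>; lowering the exponential weight of the subtracted term from
    \<open>x\<close> to \<open>y\<close> only increases the difference.\<close>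
  have same: "(x powr \<beta> - y powr \<beta>)\<^sup>2 \<le> \<beta> * ((x - y) * (x powr (2 * \<beta> - 1) - y powr (2 * \<beta> - 1)))"
    if xy: "0 \<le> y" "y \<le> x" for x y
  proof -
    have e: "z powr (2 * \<beta> - 1) = z powr (\<beta> - 1) * z powr \<beta>" for z :: real
      by (simp flip: powr_add)
    have m: "y powr \<beta> \<le> x powr \<beta>" "y powr (\<beta> - 1) \<le> x powr (\<beta> - 1)"
      using xy \<beta> by (auto intro!: powr_mono2)
    have "(x powr \<beta> - y powr \<beta>)\<^sup>2 \<le> (\<beta> * x powr (\<beta> - 1) * (x - y)) * (x powr \<beta> - y powr \<beta>)"
      unfolding power2_eq_square using m xy \<beta> by (intro mult_right_mono powr_diff_le) auto
    also have "\<dots> = \<beta> * ((x - y) * (x powr (\<beta> - 1) * x powr \<beta> - x powr (\<beta> - 1) * y powr \<beta>))"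
      by (simp add: algebra_simps)
    also have "\<dots> \<le> \<beta> * ((x - y) * (x powr (\<beta> - 1) * x powr \<beta> - y powr (\<beta> - 1) * y powr \<beta>))"
      using m xy \<beta> by (intro mult_left_mono diff_mono mult_right_mono) auto
    finally show ?thesis by (simp add: e)
  qed
  \<comment> \<open>Opposite signs: the cross term of the square is dropped, and the mixed products
    on the right are nonnegative.\<close>
  have opp: "(x powr \<beta> - y powr \<beta>)\<^sup>2 \<le> \<beta> * ((x + y) * (x powr (2 * \<beta> - 1) + y powr (2 * \<beta> - 1)))"
    if xy: "0 \<le> y" "0 \<le> x" for x y
  proof -
    have e: "(z powr \<beta>)\<^sup>2 = z * z powr (2 * \<beta> - 1)" if "0 \<le> z" for z :: real
      using that by (cases "z = 0") (auto simp: power2_eq_square powr_diff simp flip: powr_add)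
    have "(x powr \<beta> - y powr \<beta>)\<^sup>2 \<le> (x powr \<beta>)\<^sup>2 + (y powr \<beta>)\<^sup>2"
      by (simp add: power2_diff)
    also have "\<dots> \<le> (x + y) * (x powr (2 * \<beta> - 1) + y powr (2 * \<beta> - 1))"
      using xy by (simp add: e algebra_simps)
    also have "\<dots> \<le> \<beta> * \<dots>"
      using xy \<beta> mult_right_mono[of 1 \<beta> "(x + y) * (x powr (2 * \<beta> - 1) + y powr (2 * \<beta> - 1))"] by simp
    finally show ?thesis .
  qed
  \<comment> \<open>The inequality is invariant under swapping \<open>s\<close> and \<open>t\<close>
    and under changing both signs, so the six cases reduce to the two above.\<close>
  consider "0 \<le> t" "t \<le> s" | "0 \<le> s" "s \<le> t" | "s \<le> 0" "t \<le> s" | "t \<le> 0" "s \<le> t"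
    | "0 < s" "t < 0" | "s < 0" "0 < t" by linarith
  then show ?thesis
  proof cases
    case 1 then show ?thesis using same[of t s] by (cases "t = 0"; cases "s = 0") auto
  next
    case 2 then show ?thesis using same[of s t]
      by (cases "t = 0"; cases "s = 0") (auto simp: algebra_simps power2_commute)
  next
    case 3 then show ?thesis using same[of "-s" "-t"]
      by (cases "t = 0"; cases "s = 0") (auto simp: algebra_simps power2_commute)
  next
    case 4 then show ?thesis using same[of "-t" "-s"]
      by (cases "t = 0"; cases "s = 0") (auto simp: algebra_simps power2_commute)
  next
    case 5 then show ?thesis using opp[of "-t" s] by auto
  next
    case 6 then show ?thesis using opp[of t "-s"] by (auto simp: algebra_simps)
  qed
qed

text \<open>If X exceeds 2Kk, then Kk is less than X/2 and is absorbed on the left; dividing the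
  rest by \<open>X powr s\<close> leaves a power of X that can be inverted. This is the origin of
  the factors 2K in the final bound.\<close>

lemma absorb_power:
  fixes X Y K k s :: real
  assumes s: "0 \<le> s" "s < 1" and X: "0 \<le> X" and Y: "0 \<le> Y" and K: "0 < K" and k: "0 \<le> k"
    and le: "X \<le> K * (X powr s * Y powr (1 - s) + k)"
  shows "X \<le> (2 * K) powr (1 / (1 - s)) * Y + 2 * K * k"
proof (cases "X \<le> 2 * K * k")
  case True
  then show ?thesis using Y by (simp add: add_increasing)
next
  case False
  then have "0 < X" using K k by (smt (verit) mult_nonneg_nonneg)
  have "X \<le> 2 * K * (X powr s * Y powr (1 - s))"
    using False le by (simp add: algebra_simps)
  then have "X powr s * X powr (1 - s) \<le> X powr s * (2 * K * Y powr (1 - s))"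
    using \<open>0 < X\<close> by (simp flip: powr_add) (simp add: algebra_simps)
  then have "X powr (1 - s) \<le> 2 * K * Y powr (1 - s)"
    using \<open>0 < X\<close> by simp
  then have "(X powr (1 - s)) powr (1 / (1 - s)) \<le> (2 * K * Y powr (1 - s)) powr (1 / (1 - s))"
    using s by (intro powr_mono2) auto
  then have "X \<le> (2 * K) powr (1 / (1 - s)) * Y"
    using s X Y by (simp add: powr_mult powr_powr)
  then show ?thesis using K k by (smt (verit) mult_nonneg_nonneg)
qed

text \<open>The step is iterated along \<beta> = \<open>\<rho> ^ m\<close>, so the norm exponents
  \<kappa>\<open>\<rho> ^ m\<close> tend to infinity while the product of the constants stays
  bounded.\<close>

lemma moser_iteration:
  fixes u :: "'x \<Rightarrow> real" and X :: "'x set" and H \<kappa> \<rho> C k :: real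
  defines "N \<equiv> \<lambda>r. (\<Sum>x\<in>X. \<bar>u x\<bar> powr r * H) powr (1 / r)"
  assumes X: "finite X" and H: "0 < H" and \<kappa>: "0 < \<kappa>" and \<rho>: "1 < \<rho>" and C: "0 \<le> C" and k: "0 \<le> k"
    and step: "\<And>\<beta>. 1 \<le> \<beta> \<Longrightarrow> N (\<rho> * \<kappa> * \<beta>) \<le> (C * \<beta>) powr (1 / \<beta>) * max (N (\<kappa> * \<beta>)) k"
    and x: "x \<in> X"
  shows "\<bar>u x\<bar> \<le> max \<rho> C powr ((\<rho> / (\<rho> - 1))\<^sup>2) * max (N \<kappa>) k"
proof -
  define L where "L = max \<rho> C"
  define M where "M m = max (N (\<kappa> * \<rho> ^ m)) k" for m
  define S where "S m = (\<Sum>j<m. real (Suc j) * (1 / \<rho>) ^ j)" for m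
  have L: "1 < L" "\<rho> \<le> L" "C \<le> L" using \<rho> by (auto simp: L_def)
  have M0: "0 \<le> M m" for m using k by (auto simp: M_def)
  have Mstep: "M (Suc m) \<le> L powr (real (Suc m) * (1 / \<rho>) ^ m) * M m" for m
  proof -
    let ?c = "L powr (real (Suc m) * (1 / \<rho>) ^ m)"
    have \<rho>m: "1 \<le> \<rho> ^ m" using \<rho> by simp
    have c1: "1 \<le> ?c" using L \<rho> by (intro ge_one_powr_ge_zero) auto
    \<comment> \<open>Bounding both C and \<rho> by L collects the whole constant of step m into one
      power of L, with exponent (m + 1)/\<open>\<rho> ^ m\<close>.\<close>
    have "C * \<rho> ^ m \<le> L * L ^ m"
      using L \<rho> C by (intro mult_mono power_mono) auto
    also have "\<dots> = L powr real (Suc m)"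
      using L by (subst powr_realpow) auto
    finally have "(C * \<rho> ^ m) powr (1 / \<rho> ^ m) \<le> (L powr real (Suc m)) powr (1 / \<rho> ^ m)"
      using C \<rho>m by (intro powr_mono2) auto
    also have "\<dots> = ?c" by (simp add: powr_powr power_divide)
    finally have "(C * \<rho> ^ m) powr (1 / \<rho> ^ m) * M m \<le> ?c * M m"
      using M0 by (rule mult_right_mono)
    moreover have "N (\<kappa> * \<rho> ^ Suc m) \<le> (C * \<rho> ^ m) powr (1 / \<rho> ^ m) * M m"
      using step[OF \<rho>m] by (simp add: M_def mult_ac)
    \<comment> \<open>Since every step constant is at least 1, the floor \<open>k\<close> in the
      maximum survives the step without an extra term.\<close>
    moreover have "k \<le> ?c * M m"
      using c1 M0[of m] mult_mono[of 1 ?c k "M m"] k by (simp add: M_def)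
    ultimately show ?thesis by (simp add: M_def[of "Suc m"])
  qed
  have MS: "M m \<le> L powr S m * M 0" for m
  proof (induction m)
    case (Suc m)
    have "M (Suc m) \<le> L powr (real (Suc m) * (1 / \<rho>) ^ m) * (L powr S m * M 0)"
      using Mstep[of m] Suc by (meson mult_left_mono order_trans powr_ge_zero)
    then show ?case by (simp add: S_def powr_add mult_ac)
  qed (simp add: S_def L less_imp_neq[symmetric] order_less_trans[OF zero_less_one])
  have SS: "S m \<le> (\<rho> / (\<rho> - 1))\<^sup>2" for m
  proof -
    \<comment> \<open>The differentiated geometric series evaluates the total exponent to the square
      of \<rho>/(\<rho> - 1).\<close>
    have "(\<lambda>j. real (Suc j) * (1 / \<rho>) ^ j) sums (1 / (1 - 1 / \<rho>)\<^sup>2)"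
      using \<rho> geometric_deriv_sums[of "1 / \<rho>"] by simp
    moreover have "1 / (1 - 1 / \<rho>)\<^sup>2 = (\<rho> / (\<rho> - 1))\<^sup>2"
      using \<rho> by (simp add: field_simps power2_eq_square)
    ultimately show ?thesis unfolding S_def
      using \<rho> sum_le_suminf[of "\<lambda>j. real (Suc j) * (1 / \<rho>) ^ j" "{..<m}"] by (auto simp: sums_iff)
  qed
  define R where "R = L powr ((\<rho> / (\<rho> - 1))\<^sup>2) * M 0"
  have MR: "M m \<le> R" for m
    using MS[of m] L SS[of m] M0[of 0] unfolding R_def
    by (meson mult_right_mono order_trans powr_mono less_imp_le)
  \<comment> \<open>A single node bounds the norm from below up to a power of its weight
    \<open>H\<close>, and that power tends to 1 as the exponent grows.\<close>
  have bound: "\<bar>u x\<bar> * H powr (1 / (\<kappa> * \<rho> ^ m)) \<le> R" for m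
  proof -
    let ?r = "\<kappa> * \<rho> ^ m"
    have r: "0 < ?r" using \<kappa> \<rho> by simp
    have "\<bar>u x\<bar> powr ?r * H \<le> (\<Sum>x\<in>X. \<bar>u x\<bar> powr ?r * H)"
      using H X x by (intro member_le_sum) auto
    then have "(\<bar>u x\<bar> powr ?r * H) powr (1 / ?r) \<le> N ?r"
      unfolding N_def using r H by (intro powr_mono2) auto
    then have "\<bar>u x\<bar> * H powr (1 / ?r) \<le> N ?r"
      using r \<kappa> \<rho> by (simp add: powr_mult powr_powr)
    then show ?thesis using MR[of m] by (simp add: M_def)
  qed
  have "(\<lambda>m. 1 / \<kappa> * inverse \<rho> ^ m) \<longlonglongrightarrow> 1 / \<kappa> * 0"
    using \<rho> by (intro tendsto_mult tendsto_const LIMSEQ_power_zero) (auto simp: field_simps)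
  then have "(\<lambda>m. 1 / (\<kappa> * \<rho> ^ m)) \<longlonglongrightarrow> 0"
    by (simp add: power_inverse field_simps)
  then have "(\<lambda>m. \<bar>u x\<bar> * H powr (1 / (\<kappa> * \<rho> ^ m))) \<longlonglongrightarrow> \<bar>u x\<bar> * H powr 0"
    using H by (intro tendsto_mult tendsto_const tendsto_powr) auto
  then have "\<bar>u x\<bar> \<le> R"
    using bound H by (intro LIMSEQ_le_const2[of _ "\<bar>u x\<bar>" R]) auto
  then show ?thesis by (simp add: R_def M_def L_def)
qed

section \<open>The mesh and summation by parts\<close>

locale box_mesh =
  fixes n :: nat and a b h :: "nat \<Rightarrow> real"
  assumes n2: "2 \<le> n" and mesh: "admissible_mesh n a b h"
begin

abbreviation "B \<equiv> OmegaBar_h n a b h"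
abbreviation "W \<equiv> Omega_h n a b h"
abbreviation "H \<equiv> hprod n h"

text \<open>The empty default for \<open>i \<ge> n\<close> makes every node set finite, as the
  Loomis--Whitney lemmas ask for all indices.\<close>

definition nodes :: "nat \<Rightarrow> real set" where
  "nodes i = (if i < n then {a i..b i} \<inter> range (\<lambda>z::int. h i * of_int z) else {})"

definition shift :: "nat \<Rightarrow> (nat \<Rightarrow> real) \<Rightarrow> nat \<Rightarrow> real" where
  "shift i x = x(i := x i + h i)"

text \<open>Vanishing is required at all points outside \<open>W\<close>, not only at boundary
  nodes, so that sums over \<open>B\<close> can be translated without boundary terms.\<close>

definition vanishing :: "((nat \<Rightarrow> real) \<Rightarrow> real) \<Rightarrow> bool" where
  "vanishing v \<longleftrightarrow> (\<forall>x. x \<notin> W \<longrightarrow> v x = 0)"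

text \<open>The sum includes the upper face that \<open>normD\<close> leaves out; for vanishing
  functions the extra terms are zero.\<close>

definition energy :: "nat \<Rightarrow> ((nat \<Rightarrow> real) \<Rightarrow> real) \<Rightarrow> real" where
  "energy i v = (\<Sum>x\<in>B. (Dplus h i v x)\<^sup>2 * H)"

lemma mesh_ints:
  assumes "i < n"
  obtains K L :: int where "a i = of_int K * h i" "b i = of_int L * h i" "L - K > 1" "h i > 0"
  using mesh assms unfolding admissible_mesh_def by metis

lemma h_pos: "i < n \<Longrightarrow> 0 < h i"
  using mesh unfolding admissible_mesh_def by auto

lemma H_pos: "0 < H"
  unfolding hprod_def using h_pos by (intro prod_pos) auto

lemma nodes_eq:
  assumes "i < n" "a i = of_int K * h i" "b i = of_int L * h i" "h i > 0"
  shows "nodes i = (\<lambda>z. h i * of_int z) ` {K..L}"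
  using assms by (auto simp: nodes_def mult.commute[of "h i"])

lemma finite_nodes: "finite (nodes i)"
proof (cases "i < n")
  case True
  then obtain K L :: int where "a i = of_int K * h i" "b i = of_int L * h i" "h i > 0"
    using mesh_ints by metis
  then show ?thesis using True by (simp add: nodes_eq)
qed (simp add: nodes_def)

lemma B_eq: "B = {y. (\<forall>i<n. y i \<in> nodes i) \<and> (\<forall>i\<ge>n. y i = 0)}"
  unfolding OmegaBar_h_def closed_box_def grid_def nodes_def by (auto simp: image_iff)

lemma finite_B: "finite B"
  unfolding B_eq using slice_sum_eq_sum(1)[of nodes n n "\<lambda>_. 0"] finite_nodes by simp

lemma W_subset_B: "W \<subseteq> B"
  unfolding Omega_h_def OmegaBar_h_def open_box_def closed_box_def by auto

lemma B_minus_W: "B - W = dOmega_h n a b h"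
  unfolding dOmega_h_def Omega_h_def OmegaBar_h_def by auto

lemma neighbours_in_B:
  assumes "x \<in> W" "i < n"
  shows "shift i x \<in> B" "x(i := x i - h i) \<in> B"
proof -
  obtain K L :: int where KL: "a i = of_int K * h i" "b i = of_int L * h i" "h i > 0"
    using mesh_ints assms by metis
  obtain z :: int where z: "x i = h i * of_int z" "a i < x i" "x i < b i"
    using assms unfolding Omega_h_def open_box_def grid_def by blast
  have "K < z" "z < L" using z KL by (auto simp: mult.commute[of "h i"])
  then have "h i * of_int (z + 1) \<in> nodes i" "h i * of_int (z - 1) \<in> nodes i"
    unfolding nodes_eq[OF assms(2) KL] by (auto simp del: of_int_add of_int_diff of_int_1)
  moreover have "x \<in> B" using assms W_subset_B by auto
  ultimately show "shift i x \<in> B" "x(i := x i - h i) \<in> B"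
    using z assms by (auto simp: B_eq shift_def algebra_simps)
qed

lemma inj_shift: "inj (shift i)"
proof (rule injI)
  fix x y assume eq: "shift i x = shift i y"
  have "x j = y j" for j
    using fun_cong[OF eq, of j] by (cases "j = i") (auto simp: shift_def)
  then show "x = y" by auto
qed

text \<open>Every interior node is the shift of its lower neighbour, which lies in \<open>B\<close>;
  so the shifted mesh still covers the set \<open>W\<close> on which \<open>F\<close> can be
  nonzero.\<close>

lemma sum_shift:
  assumes "i < n" and F: "\<And>x. x \<notin> W \<Longrightarrow> F x = (0::real)"
  shows "(\<Sum>x\<in>B. F (shift i x)) = (\<Sum>x\<in>B. F x)"
proof -
  have "(\<Sum>x\<in>B. F (shift i x)) = sum F (shift i ` B)"
    using inj_shift by (subst sum.reindex) (auto intro: inj_on_subset)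
  also have "\<dots> = sum F W"
  proof (rule sum.mono_neutral_right)
    show "W \<subseteq> shift i ` B"
    proof
      fix x assume x: "x \<in> W"
      have "x = shift i (x(i := x i - h i))" by (simp add: shift_def)
      then show "x \<in> shift i ` B" using neighbours_in_B(2)[OF x assms(1)] by blast
    qed
  qed (use F finite_B in auto)
  also have "\<dots> = sum F B"
    using F finite_B W_subset_B by (intro sum.mono_neutral_left) auto
  finally show ?thesis .
qed

text \<open>In each direction, translating the diagonal term u v and the backward-neighbour term
  turns the second difference times \<open>v\<close> into the product of forward
  differences.\<close>

lemma summation_by_parts:
  assumes u: "vanishing u" and v: "vanishing v"
  shows "(\<Sum>x\<in>B. - lap_h n h u x * v x) = (\<Sum>i<n. \<Sum>x\<in>B. Dplus h i u x * Dplus h i v x)"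
proof -
  have dir: "(\<Sum>x\<in>B. - ((u (x(i := x i + h i)) - 2 * u x + u (x(i := x i - h i))) / (h i)\<^sup>2) * v x)
      = (\<Sum>x\<in>B. Dplus h i u x * Dplus h i v x)" if i: "i < n" for i
  proof -
    let ?b = "\<lambda>x. x(i := x i - h i)"
    have h: "h i > 0" using h_pos i by simp
    have unshift: "?b (shift i x) = x" for x by (simp add: shift_def)
    have "(\<Sum>x\<in>B. u (shift i x) * v (shift i x)) = (\<Sum>x\<in>B. u x * v x)"
      using u v i by (intro sum_shift) (auto simp: vanishing_def)
    moreover have "(\<Sum>x\<in>B. u (?b (shift i x)) * v (shift i x)) = (\<Sum>x\<in>B. u (?b x) * v x)"
      using u v i by (intro sum_shift[where F="\<lambda>x. u (?b x) * v x"]) (auto simp: vanishing_def)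
    ultimately have "(\<Sum>x\<in>B. - (u (shift i x) - 2 * u x + u (?b x)) * v x)
        = (\<Sum>x\<in>B. (u (shift i x) - u x) * (v (shift i x) - v x))"
      unfolding unshift by (simp add: algebra_simps sum.distrib sum_subtractf sum_negf sum_distrib_left)
    then have "(\<Sum>x\<in>B. - (u (shift i x) - 2 * u x + u (?b x)) * v x) / (h i)\<^sup>2
        = (\<Sum>x\<in>B. (u (shift i x) - u x) * (v (shift i x) - v x)) / (h i)\<^sup>2" by simp
    moreover have "(\<Sum>x\<in>B. - ((u (x(i := x i + h i)) - 2 * u x + u (?b x)) / (h i)\<^sup>2) * v x)
        = (\<Sum>x\<in>B. - (u (shift i x) - 2 * u x + u (?b x)) * v x) / (h i)\<^sup>2"
      unfolding sum_divide_distrib shift_def using h by (intro sum.cong) (auto simp: field_simps)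
    ultimately show ?thesis
      using h by (simp add: sum_divide_distrib Dplus_def shift_def power2_eq_square)
  qed
  have "(\<Sum>x\<in>B. - lap_h n h u x * v x) = (\<Sum>x\<in>B. \<Sum>i<n. - ((u (x(i := x i + h i)) - 2 * u x + u (x(i := x i - h i))) / (h i)\<^sup>2) * v x)"
    by (simp add: lap_h_def sum_distrib_right flip: sum_negf)
  also have "\<dots> = (\<Sum>i<n. \<Sum>x\<in>B. Dplus h i u x * Dplus h i v x)"
    using dir by (subst sum.swap) simp
  finally show ?thesis .
qed

lemma energy_nonneg: "0 \<le> energy i v"
  unfolding energy_def using H_pos by (intro sum_nonneg) auto

lemma normD_nonneg: "0 \<le> normD n a b h v"
  unfolding normD_def using H_pos by (intro real_sqrt_ge_zero sum_nonneg) auto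

text \<open>At a node with \<open>x i = b i\<close> both the node and its upper neighbour lie
  outside \<open>W\<close>, so its forward difference is zero.\<close>

lemma normD_vanishing:
  assumes v: "vanishing v"
  shows "(normD n a b h v)\<^sup>2 = (\<Sum>i<n. energy i v)"
proof -
  have "(\<Sum>x\<in>B - dOmega_plus_h n a b h i. (Dplus h i v x)\<^sup>2 * H) = energy i v" if i: "i < n" for i
    unfolding energy_def
  proof (rule sum.mono_neutral_left)
    show "\<forall>x\<in>B - (B - dOmega_plus_h n a b h i). (Dplus h i v x)\<^sup>2 * H = 0"
    proof
      fix x assume "x \<in> B - (B - dOmega_plus_h n a b h i)"
      then have "x i = b i" unfolding dOmega_plus_h_def by auto
      then have "x \<notin> W" "x(i := x i + h i) \<notin> W"
        using h_pos[OF i] i unfolding Omega_h_def open_box_def by force+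
      then show "(Dplus h i v x)\<^sup>2 * H = 0"
        using v by (simp add: vanishing_def Dplus_def)
    qed
  qed (use finite_B in auto)
  then have "normD n a b h v = sqrt (\<Sum>i<n. energy i v)"
    unfolding normD_def by simp
  then show ?thesis by (simp add: energy_nonneg sum_nonneg)
qed

text \<open>Telescoping along direction \<open>i\<close> from the face \<open>x i = a i\<close>,
  where \<open>w\<close> is zero, up to \<open>x\<close>; the remaining terms of the line are added
  because they are nonnegative.\<close>

lemma line_bound:
  assumes i: "i < n" and x: "x \<in> B" and w: "vanishing w"
  shows "\<bar>w x\<bar> \<le> (\<Sum>t\<in>nodes i. \<bar>w (x(i := t + h i)) - w (x(i := t))\<bar>)"
proof -
  obtain K L :: int where KL: "a i = of_int K * h i" "b i = of_int L * h i" "h i > 0"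
    using mesh_ints i by metis
  obtain z where z: "K \<le> z" "z \<le> L" "x i = h i * of_int z"
  proof -
    have "x i \<in> (\<lambda>z. h i * of_int z) ` {K..L}"
      using x i by (simp add: B_eq flip: nodes_eq[OF i KL])
    then show ?thesis using that by auto
  qed
  define f where "f j = w (x(i := h i * of_int j))" for j :: int
  have fK: "f K = 0"
  proof -
    have "x(i := h i * of_int K) \<notin> W"
      using i KL unfolding Omega_h_def open_box_def by (auto simp: mult.commute)
    then show ?thesis using w by (simp add: f_def vanishing_def)
  qed
  have tele: "\<bar>f y\<bar> \<le> (\<Sum>j\<in>{K..<y}. \<bar>f (j + 1) - f j\<bar>)" if "K \<le> y" for y
    using that
  proof (induction y rule: int_ge_induct)
    case (step y)
    have "{K..<y + 1} = insert y {K..<y}" using step by auto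
    then show ?case using step by simp
  qed (simp add: fK)
  have "\<bar>w x\<bar> = \<bar>f z\<bar>" unfolding f_def z(3)[symmetric] by simp
  also have "\<dots> \<le> (\<Sum>j\<in>{K..<z}. \<bar>f (j + 1) - f j\<bar>)" using tele z by simp
  also have "\<dots> \<le> (\<Sum>j\<in>{K..L}. \<bar>f (j + 1) - f j\<bar>)" using z by (intro sum_mono2) auto
  also have "\<dots> = (\<Sum>t\<in>nodes i. \<bar>w (x(i := t + h i)) - w (x(i := t))\<bar>)"
    unfolding nodes_eq[OF i KL] using KL
    by (subst sum.reindex) (auto simp: inj_on_def f_def algebra_simps)
  finally show ?thesis .
qed

text \<open>Direction \<open>i\<close> has at most L - K - 1 interior nodes, so their cells fit into
  the box. Over the closed mesh there would be L - K + 1 nodes and the bound would fail.\<close>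

lemma volume_bound: "(\<Sum>x\<in>W. H) \<le> box_vol n a b"
proof -
  define inner where "inner i = (if i < n then {a i<..<b i} \<inter> nodes i else {})" for i
  have fin: "finite (inner i)" for i using finite_nodes by (simp add: inner_def)
  have slice: "slice_sum inner n m (\<lambda>_. 1) x = (\<Prod>i<m. real (card (inner i)))" if "m \<le> n" for m x
    using that by (induction m arbitrary: x) auto
  have W: "W = {y. (\<forall>i<n. y i \<in> inner i) \<and> (\<forall>i\<ge>n. y i = 0)}"
    unfolding Omega_h_def open_box_def grid_def nodes_def inner_def by auto force+
  have "(\<Sum>x\<in>W. 1) = (\<Prod>i<n. real (card (inner i)))"
    unfolding W using slice_sum_eq_sum(2)[of inner n n "\<lambda>_. 1" "\<lambda>_. 0"] slice[of n "\<lambda>_. 0"] fin by simp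
  then have "(\<Sum>x\<in>W. H) = (\<Prod>i<n. real (card (inner i)) * h i)"
    by (simp add: hprod_def prod.distrib)
  also have "\<dots> \<le> (\<Prod>i<n. b i - a i)"
  proof (rule prod_mono)
    fix i assume "i \<in> {..<n}"
    then have i: "i < n" by simp
    obtain K L :: int where KL: "a i = of_int K * h i" "b i = of_int L * h i" "h i > 0" and "L - K > 1"
      using mesh_ints i by metis
    have "inner i \<subseteq> (\<lambda>z. h i * of_int z) ` {K<..<L}"
      using i KL by (auto simp: inner_def nodes_eq[OF i KL] mult.commute[of "h i"])
    then have "card (inner i) \<le> card {K<..<L}"
      by (meson card_image_le card_mono finite_greaterThanLessThan_int finite_imageI le_trans)
    then have "real (card (inner i)) \<le> of_int (L - K)"
      using \<open>L - K > 1\<close> by simp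
    then have "real (card (inner i)) * h i \<le> of_int (L - K) * h i"
      using KL by (intro mult_right_mono) auto
    then show "0 \<le> real (card (inner i)) * h i \<and> real (card (inner i)) * h i \<le> b i - a i"
      using KL by (auto simp: algebra_simps)
  qed
  finally show ?thesis by (simp add: box_vol_def)
qed

lemma box_vol_pos: "0 < box_vol n a b"
  unfolding box_vol_def
proof (rule prod_pos)
  fix i assume "i \<in> {..<n}"
  then obtain K L :: int where "a i = of_int K * h i" "b i = of_int L * h i" "L - K > 1" "h i > 0"
    using mesh_ints by auto
  then show "0 < b i - a i" by (simp add: left_diff_distrib[symmetric])
qed

text \<open>The gap L - K > 1 leaves room for the node with integer coordinate K + 1.\<close>

lemma W_nonempty: "W \<noteq> {}"
proof -
  have "\<exists>t. a i < t \<and> t < b i \<and> (\<exists>z::int. t = h i * of_int z)" if i: "i < n" for i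
  proof -
    obtain K L :: int where KL: "a i = of_int K * h i" "b i = of_int L * h i" "L - K > 1" "h i > 0"
      using mesh_ints i by metis
    have "a i < h i * of_int (K + 1)" using KL by (simp add: algebra_simps)
    moreover have "h i * of_int (K + 1) < h i * of_int L" using KL by (intro mult_strict_left_mono) auto
    ultimately show ?thesis using KL by (metis mult.commute)
  qed
  then obtain y where y: "\<And>i. i < n \<Longrightarrow> a i < y i \<and> y i < b i \<and> (\<exists>z::int. y i = h i * of_int z)" by metis
  have "(\<lambda>i. if i < n then y i else 0) \<in> W"
    using y unfolding Omega_h_def open_box_def grid_def by auto
  then show ?thesis by blast
qed

subsection \<open>Sobolev inequalities\<close>

lemma gagliardo_nirenberg:
  assumes w: "vanishing w"
  shows "(\<Sum>x\<in>B. \<bar>w x\<bar> powr (real n / (real n - 1)))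
    \<le> (\<Prod>i<n. \<Sum>x\<in>B. \<bar>w (shift i x) - w x\<bar>) powr (1 / (real n - 1))"
proof (rule gagliardo_nirenberg_sum[OF n2 finite_nodes B_eq])
  show "\<bar>w x\<bar> \<le> (\<Sum>t\<in>nodes i. \<bar>w (shift i (x(i := t))) - w (x(i := t))\<bar>)" if "i < n" "x \<in> B" for i x
    using line_bound[OF that w] by (simp add: shift_def)
qed simp

text \<open>The mean value bound is made symmetric in the two endpoints before Cauchy--Schwarz; by
  translation invariance both endpoints then contribute the same amount, hence the factor 2.\<close>

lemma sum_diff_powr_le:
  assumes i: "i < n" and v: "vanishing v" and \<gamma>: "1 \<le> \<gamma>"
  shows "(\<Sum>x\<in>B. \<bar>\<bar>v (shift i x)\<bar> powr \<gamma> - \<bar>v x\<bar> powr \<gamma>\<bar>)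
    \<le> 2 * \<gamma> * sqrt (\<Sum>x\<in>B. \<bar>v x\<bar> powr (2 * \<gamma> - 2)) * sqrt (\<Sum>x\<in>B. (v (shift i x) - v x)\<^sup>2)"
proof -
  let ?P = "sqrt (\<Sum>x\<in>B. \<bar>v x\<bar> powr (2 * \<gamma> - 2))"
  let ?E = "sqrt (\<Sum>x\<in>B. (v (shift i x) - v x)\<^sup>2)"
  let ?d = "\<lambda>x. \<bar>v (shift i x) - v x\<bar>"
  have pt: "\<bar>\<bar>s\<bar> powr \<gamma> - \<bar>t\<bar> powr \<gamma>\<bar> \<le> \<gamma> * (\<bar>s\<bar> powr (\<gamma> - 1) + \<bar>t\<bar> powr (\<gamma> - 1)) * \<bar>s - t\<bar>" for s t :: real
  proof -
    have *: "\<bar>\<bar>s\<bar> powr \<gamma> - \<bar>t\<bar> powr \<gamma>\<bar> \<le> \<gamma> * (\<bar>s\<bar> powr (\<gamma> - 1) + \<bar>t\<bar> powr (\<gamma> - 1)) * \<bar>s - t\<bar>"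
      if "\<bar>t\<bar> \<le> \<bar>s\<bar>" for s t :: real
    proof -
      have "\<bar>t\<bar> powr \<gamma> \<le> \<bar>s\<bar> powr \<gamma>" using that \<gamma> by (intro powr_mono2) auto
      then have "\<bar>\<bar>s\<bar> powr \<gamma> - \<bar>t\<bar> powr \<gamma>\<bar> \<le> \<gamma> * \<bar>s\<bar> powr (\<gamma> - 1) * (\<bar>s\<bar> - \<bar>t\<bar>)"
        using powr_diff_le[of "\<bar>t\<bar>" "\<bar>s\<bar>" \<gamma>] that \<gamma> by simp
      also have "\<dots> \<le> \<gamma> * (\<bar>s\<bar> powr (\<gamma> - 1) + \<bar>t\<bar> powr (\<gamma> - 1)) * \<bar>s - t\<bar>"
        using \<gamma> that by (intro mult_mono mult_left_mono) auto
      finally show ?thesis .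
    qed
    show ?thesis using *[of s t] *[of t s] by (cases "\<bar>t\<bar> \<le> \<bar>s\<bar>") (auto simp: algebra_simps abs_minus_commute)
  qed
  have sq: "(y powr (\<gamma> - 1))\<^sup>2 = y powr (2 * \<gamma> - 2)" for y :: real
    by (simp add: power2_eq_square algebra_simps flip: powr_add)
  have CS: "(\<Sum>x\<in>B. f x * g x) \<le> sqrt (\<Sum>x\<in>B. (f x)\<^sup>2) * sqrt (\<Sum>x\<in>B. (g x)\<^sup>2)" for f g :: "(nat \<Rightarrow> real) \<Rightarrow> real"
    using Cauchy_Schwarz_ineq_sum[of f g B] by (metis real_le_rsqrt real_sqrt_mult)
  have "(\<Sum>x\<in>B. \<bar>\<bar>v (shift i x)\<bar> powr \<gamma> - \<bar>v x\<bar> powr \<gamma>\<bar>)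
      \<le> (\<Sum>x\<in>B. \<gamma> * (\<bar>v (shift i x)\<bar> powr (\<gamma> - 1) + \<bar>v x\<bar> powr (\<gamma> - 1)) * ?d x)"
    by (intro sum_mono pt)
  also have "\<dots> = \<gamma> * ((\<Sum>x\<in>B. \<bar>v (shift i x)\<bar> powr (\<gamma> - 1) * ?d x) + (\<Sum>x\<in>B. \<bar>v x\<bar> powr (\<gamma> - 1) * ?d x))"
    by (simp add: algebra_simps sum.distrib sum_distrib_left)
  also have "\<dots> \<le> \<gamma> * (?P * ?E + ?P * ?E)"
  proof (intro mult_left_mono add_mono)
    have "(\<Sum>x\<in>B. \<bar>v (shift i x)\<bar> powr (2 * \<gamma> - 2)) = (\<Sum>x\<in>B. \<bar>v x\<bar> powr (2 * \<gamma> - 2))"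
      using v i by (intro sum_shift[where F="\<lambda>x. \<bar>v x\<bar> powr (2 * \<gamma> - 2)"]) (auto simp: vanishing_def)
    then show "(\<Sum>x\<in>B. \<bar>v (shift i x)\<bar> powr (\<gamma> - 1) * ?d x) \<le> ?P * ?E"
      using CS[of "\<lambda>x. \<bar>v (shift i x)\<bar> powr (\<gamma> - 1)" ?d] by (simp add: sq)
    show "(\<Sum>x\<in>B. \<bar>v x\<bar> powr (\<gamma> - 1) * ?d x) \<le> ?P * ?E"
      using CS[of "\<lambda>x. \<bar>v x\<bar> powr (\<gamma> - 1)" ?d] by (simp add: sq)
  qed (use \<gamma> in auto)
  finally show ?thesis by (simp add: algebra_simps)
qed

text \<open>Arithmetic-geometric mean over the directional energies, whose sum is the square of
  \<open>normD\<close>. This gives the factor 1/sqrt n in \<open>C_S n\<close>.\<close>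

lemma prod_energy_le:
  assumes v: "vanishing v"
  shows "(\<Prod>i<n. sqrt (energy i v)) \<le> (normD n a b h v / sqrt n) ^ n"
proof -
  let ?D = "normD n a b h v"
  have "(\<Prod>i<n. energy i v) powr (1 / n) \<le> (\<Sum>i<n. energy i v / n)"
    using arith_geom_mean[of "{..<n}" "\<lambda>i. energy i v"] n2 energy_nonneg by (simp add: lessThan_empty_iff)
  also have "\<dots> = (?D / sqrt n)\<^sup>2"
    by (simp add: power_divide normD_vanishing[OF v] sum_divide_distrib)
  finally have "((\<Prod>i<n. energy i v) powr (1 / n)) ^ n \<le> ((?D / sqrt n)\<^sup>2) ^ n"
    by (intro power_mono) auto
  moreover have "((\<Prod>i<n. energy i v) powr (1 / n)) ^ n = (\<Prod>i<n. energy i v)"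
    using n2 energy_nonneg powr_realpow'[of "(\<Prod>i<n. energy i v) powr (1 / n)" n]
    by (simp add: powr_powr prod_nonneg)
  ultimately have "(\<Prod>i<n. energy i v) \<le> ((?D / sqrt n) ^ n)\<^sup>2"
    by (simp add: power_mult[symmetric] mult.commute)
  then have "sqrt (\<Prod>i<n. energy i v) \<le> (?D / sqrt n) ^ n"
    using normD_nonneg by (intro real_le_lsqrt) (auto simp: prod_nonneg energy_nonneg)
  moreover have "sqrt (\<Prod>i<m. energy i v) = (\<Prod>i<m. sqrt (energy i v))" for m
    by (induction m) (auto simp: real_sqrt_mult)
  ultimately show ?thesis by simp
qed

text \<open>Gagliardo--Nirenberg applied to \<open>\<bar>v x\<bar> powr \<gamma>\<close>, with
  \<gamma> left free: for \<open>n \<ge> 3\<close> it is chosen so that both sides contain the same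
  power, for \<open>n = 2\<close> each use raises the power by two.\<close>

lemma sobolev_step:
  assumes v: "vanishing v" and \<gamma>: "1 \<le> \<gamma>"
  shows "(\<Sum>x\<in>B. \<bar>v x\<bar> powr (\<gamma> * (real n / (real n - 1))) * H)
    \<le> (2 * \<gamma> / sqrt n * sqrt (\<Sum>x\<in>B. \<bar>v x\<bar> powr (2 * \<gamma> - 2) * H) * normD n a b h v) powr (real n / (real n - 1))"
proof -
  let ?D = "normD n a b h v"
  let ?e = "1 / (real n - 1)"
  define P where "P = (\<Sum>x\<in>B. \<bar>v x\<bar> powr (2 * \<gamma> - 2) * H)"
  define Q where "Q = 2 * \<gamma> / sqrt n * sqrt P * ?D"
  have P0: "0 \<le> P" unfolding P_def using H_pos by (intro sum_nonneg) auto
  have Q0: "0 \<le> Q" unfolding Q_def using P0 \<gamma> normD_nonneg by simp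
  have e: "0 < ?e" "real n \<noteq> 1" using n2 by auto
  have w: "vanishing (\<lambda>x. \<bar>v x\<bar> powr \<gamma>)" using v by (simp add: vanishing_def)
  have di: "(\<Sum>x\<in>B. \<bar>\<bar>v (shift i x)\<bar> powr \<gamma> - \<bar>v x\<bar> powr \<gamma>\<bar>) \<le> 2 * \<gamma> * sqrt P / H * (h i * sqrt (energy i v))"
    if i: "i < n" for i
  proof -
    have hi: "0 < h i" using h_pos i .
    have 1: "(\<Sum>x\<in>B. \<bar>v x\<bar> powr (2 * \<gamma> - 2)) = P / H"
      using H_pos by (simp add: P_def flip: sum_distrib_right)
    have 2: "(\<Sum>x\<in>B. (v (shift i x) - v x)\<^sup>2) = (h i)\<^sup>2 * energy i v / H"
      using H_pos hi by (simp add: energy_def Dplus_def shift_def power_divide flip: sum_distrib_right sum_divide_distrib)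
    have "sqrt (P / H) * sqrt ((h i)\<^sup>2 * energy i v / H) = sqrt P / H * (h i * sqrt (energy i v))"
      using H_pos hi by (simp add: real_sqrt_divide real_sqrt_mult)
    then show ?thesis
      using sum_diff_powr_le[OF i v \<gamma>] by (simp add: 1 2 mult.assoc)
  qed
  have "(\<Prod>i<n. \<Sum>x\<in>B. \<bar>\<bar>v (shift i x)\<bar> powr \<gamma> - \<bar>v x\<bar> powr \<gamma>\<bar>)
      \<le> (\<Prod>i<n. 2 * \<gamma> * sqrt P / H * (h i * sqrt (energy i v)))"
    using di by (intro prod_mono) (auto intro: sum_nonneg)
  also have "\<dots> = (2 * \<gamma> * sqrt P / H) ^ n * (H * (\<Prod>i<n. sqrt (energy i v)))"
    unfolding prod.distrib[of _ "\<lambda>i. h i * sqrt (energy i v)"] prod.distrib[of h] by (simp add: hprod_def)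
  also have "\<dots> \<le> (2 * \<gamma> * sqrt P / H) ^ n * (H * (?D / sqrt n) ^ n)"
    using prod_energy_le[OF v] H_pos P0 \<gamma> by (intro mult_left_mono) auto
  also have "\<dots> = Q ^ n * (H / H ^ n)"
    by (simp add: Q_def power_mult_distrib power_divide mult_ac)
  finally have prod: "(\<Prod>i<n. \<Sum>x\<in>B. \<bar>\<bar>v (shift i x)\<bar> powr \<gamma> - \<bar>v x\<bar> powr \<gamma>\<bar>) \<le> Q ^ n * (H / H ^ n)" .
  have "(\<Sum>x\<in>B. \<bar>v x\<bar> powr (\<gamma> * (real n / (real n - 1)))) = (\<Sum>x\<in>B. \<bar>\<bar>v x\<bar> powr \<gamma>\<bar> powr (real n / (real n - 1)))"
    by (simp add: powr_powr)
  also have "\<dots> \<le> (\<Prod>i<n. \<Sum>x\<in>B. \<bar>\<bar>v (shift i x)\<bar> powr \<gamma> - \<bar>v x\<bar> powr \<gamma>\<bar>) powr ?e"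
    by (rule gagliardo_nirenberg[OF w])
  also have "\<dots> \<le> (Q ^ n * (H / H ^ n)) powr ?e"
    using prod e by (intro powr_mono2) (auto intro!: prod_nonneg sum_nonneg)
  also have "\<dots> = Q powr (real n / (real n - 1)) * (1 / H)"
  proof -
    have "(Q ^ n) powr ?e = Q powr (real n / (real n - 1))"
      using Q0 n2 by (cases "Q = 0") (auto simp: powr_powr simp flip: powr_realpow)
    \<comment> \<open>Each directional sum carries \<open>h i / H\<close>, so the product scales
      like H to the power 1 - n; its root is the weight 1/H needed on the left.\<close>
    moreover have "(H / H ^ n) powr ?e = 1 / H"
    proof -
      have "H / H ^ n = H powr (1 - real n)"
        using H_pos by (simp add: powr_diff powr_realpow)
      then have "(H / H ^ n) powr ?e = H powr ((1 - real n) * ?e)"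
        by (simp add: powr_powr)
      also have "(1 - real n) * ?e = -1" using e by (simp add: field_simps)
      finally show ?thesis using H_pos by (simp add: powr_minus_divide)
    qed
    ultimately show ?thesis by (simp only: powr_mult)
  qed
  finally have "(\<Sum>x\<in>B. \<bar>v x\<bar> powr (\<gamma> * (real n / (real n - 1)))) \<le> Q powr (real n / (real n - 1)) * (1 / H)" .
  then have "(\<Sum>x\<in>B. \<bar>v x\<bar> powr (\<gamma> * (real n / (real n - 1)))) * H \<le> Q powr (real n / (real n - 1))"
    using H_pos by (simp add: pos_le_divide_eq)
  then show ?thesis by (simp add: Q_def P_def sum_distrib_right)
qed

definition normLp :: "real \<Rightarrow> ((nat \<Rightarrow> real) \<Rightarrow> real) \<Rightarrow> real" where
  "normLp r v = (\<Sum>x\<in>B. \<bar>v x\<bar> powr r * H) powr (1 / r)"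

lemma normLp_nonneg: "0 \<le> normLp r v"
  by (simp add: normLp_def)

lemma sum_powr_nonneg: "0 \<le> (\<Sum>x\<in>B. \<bar>v x\<bar> powr r * H)"
  using H_pos by (intro sum_nonneg) auto

lemma normLp_powr:
  "0 < r \<Longrightarrow> normLp r v powr s = (\<Sum>x\<in>B. \<bar>v x\<bar> powr r * H) powr (s / r)"
  by (simp add: normLp_def powr_powr)

lemma normLp_powr_self: "0 < r \<Longrightarrow> normLp r v powr r = (\<Sum>x\<in>B. \<bar>v x\<bar> powr r * H)"
  using sum_powr_nonneg by (simp add: normLp_powr)

lemma normLp_leI:
  assumes "0 < r" "0 \<le> c" "(\<Sum>x\<in>B. \<bar>v x\<bar> powr r * H) \<le> c powr r"
  shows "normLp r v \<le> c"
proof -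
  have "normLp r v \<le> (c powr r) powr (1 / r)"
    unfolding normLp_def using assms sum_powr_nonneg by (intro powr_mono2) auto
  then show ?thesis using assms by (simp add: powr_powr)
qed

text \<open>The choice \<gamma> = 2(n-1)/(n-2) makes both exponents in \<open>sobolev_step\<close>
  equal to 2n/(n-2). The common integral \<open>I\<close> then cancels up to the desired root, and
  the constant is exactly \<open>C_S n\<close>.\<close>

lemma sobolev:
  assumes n: "3 \<le> n" and v: "vanishing v"
  shows "normLp (2 * real n / (real n - 2)) v \<le> C_S n * normD n a b h v"
proof -
  let ?r = "2 * real n / (real n - 2)" and ?D = "normD n a b h v"
  let ?\<gamma> = "2 * (real n - 1) / (real n - 2)" and ?N = "normLp (2 * real n / (real n - 2)) v"
  define I where "I = (\<Sum>x\<in>B. \<bar>v x\<bar> powr ?r * H)"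
  have r: "0 < ?r" using n by simp
  have I: "?N powr ?r = I" "0 \<le> I" unfolding I_def using normLp_powr_self[OF r] sum_powr_nonneg by auto
  have e1: "?\<gamma> * (real n / (real n - 1)) = ?r" "2 * ?\<gamma> - 2 = ?r" "1 \<le> ?\<gamma>"
    using n by (auto simp: divide_simps)
  have c: "2 * ?\<gamma> / sqrt n = C_S n" using n by (simp add: C_S_def mult_ac)
  have C0: "0 \<le> C_S n" using n by (simp add: C_S_def)
  have "I \<le> (C_S n * sqrt I * ?D) powr (real n / (real n - 1))"
    using sobolev_step[OF v e1(3)] unfolding e1 c I_def .
  then have "I powr ((real n - 1) / real n) \<le> ((C_S n * sqrt I * ?D) powr (real n / (real n - 1))) powr ((real n - 1) / real n)"
    using n I by (intro powr_mono2) auto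
  also have "\<dots> = C_S n * sqrt I * ?D"
    using n C0 I normD_nonneg by (simp add: powr_powr)
  finally have main: "I powr ((real n - 1) / real n) \<le> C_S n * sqrt I * ?D" .
  show ?thesis
  proof (cases "I = 0")
    case True
    then show ?thesis using C0 normD_nonneg by (simp add: normLp_def I_def)
  next
    case False
    then have Ip: "0 < I" using I by simp
    have "(real n - 1) / real n = 1 / ?r + 1 / 2" using n by (simp add: field_simps)
    then have "I powr (1 / ?r) * sqrt I \<le> C_S n * ?D * sqrt I"
      using main Ip by (simp add: powr_add powr_half_sqrt mult_ac)
    then have "I powr (1 / ?r) \<le> C_S n * ?D"
      using Ip by simp
    then show ?thesis by (simp add: normLp_def I_def)
  qed
qed

text \<open>Poincare's inequality starts the induction. The factor 1 + CP serves both as a bound for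
  CP in the base case and as a factor at least 1 in each later step.\<close>

lemma sum_even_power_2d:
  assumes n: "n = 2" and v: "vanishing v" and CP: "0 \<le> CP"
    and poinc: "normL2 n a b h v \<le> CP * normD n a b h v"
  shows "(\<Sum>x\<in>B. \<bar>v x\<bar> powr (2 * real (Suc m)) * H) \<le> (sqrt 2 * real (Suc m) * (1 + CP) * normD n a b h v) ^ (2 * Suc m)"
proof (induction m)
  case 0
  let ?D = "normD n a b h v"
  have "(\<Sum>x\<in>B. \<bar>v x\<bar> powr (2 * real (Suc 0)) * H) = (normL2 n a b h v)\<^sup>2"
    using H_pos by (simp add: normL2_def sum_nonneg powr_numeral)
  also have "\<dots> \<le> (CP * ?D)\<^sup>2"
    using poinc H_pos by (intro power_mono) (auto simp: normL2_def intro!: sum_nonneg)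
  also have "\<dots> \<le> (sqrt 2 * (1 + CP) * ?D)\<^sup>2"
  proof (intro power_mono mult_right_mono)
    have "1 * CP \<le> sqrt 2 * (1 + CP)" using CP by (intro mult_mono) auto
    then show "CP \<le> sqrt 2 * (1 + CP)" by simp
  qed (use CP normD_nonneg in auto)
  finally show ?case by simp
next
  case (Suc m)
  let ?D = "normD n a b h v" and ?I = "\<lambda>m. \<Sum>x\<in>B. \<bar>v x\<bar> powr (2 * real m) * H"
  define Q where "Q k = sqrt 2 * real k * (1 + CP) * ?D" for k
  have Q0: "0 \<le> Q k" for k using CP normD_nonneg by (simp add: Q_def)
  have QS: "Q (Suc m) \<le> Q (Suc (Suc m))"
    unfolding Q_def using CP normD_nonneg by (intro mult_right_mono mult_left_mono) auto
  have e: "real (Suc (Suc m)) * 2 = 2 * real (Suc (Suc m))"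
    "2 * real (Suc (Suc m)) - 2 = 2 * real (Suc m)" "real n / (real n - 1) = 2" "1 \<le> real (Suc (Suc m))"
    "sqrt (real n) = sqrt 2"
    using n by auto
  \<comment> \<open>Here \<gamma> = m + 2: in dimension 2 the exponents in
    \<open>sobolev_step\<close> are 2\<gamma> on the left and 2\<gamma> - 2 on the right.\<close>
  have "?I (Suc (Suc m)) \<le> (2 * real (Suc (Suc m)) / sqrt 2 * sqrt (?I (Suc m)) * ?D) powr 2"
    using sobolev_step[OF v e(4)] unfolding e .
  also have "\<dots> = (2 * real (Suc (Suc m)) / sqrt 2 * sqrt (?I (Suc m)) * ?D)\<^sup>2"
    using normD_nonneg sum_powr_nonneg by (intro powr_numeral) simp
  also have "\<dots> = (sqrt 2 * real (Suc (Suc m)) * ?D)\<^sup>2 * ?I (Suc m)"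
  proof -
    have "(2 * c / sqrt 2 * sqrt I * D)\<^sup>2 = (sqrt 2 * c * D)\<^sup>2 * I" if "0 \<le> I" for c I D :: real
      using that by (simp add: power_mult_distrib power_divide)
    then show ?thesis using sum_powr_nonneg by blast
  qed
  also have "\<dots> \<le> (Q (Suc (Suc m)))\<^sup>2 * Q (Suc (Suc m)) ^ (2 * Suc m)"
  proof (rule mult_mono)
    show "(sqrt 2 * real (Suc (Suc m)) * ?D)\<^sup>2 \<le> (Q (Suc (Suc m)))\<^sup>2"
      unfolding Q_def using CP normD_nonneg by (intro power_mono) (auto simp: algebra_simps)
    have "?I (Suc m) \<le> Q (Suc m) ^ (2 * Suc m)"
      using Suc unfolding Q_def .
    also have "\<dots> \<le> Q (Suc (Suc m)) ^ (2 * Suc m)"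
      using QS Q0 by (rule power_mono)
    finally show "?I (Suc m) \<le> Q (Suc (Suc m)) ^ (2 * Suc m)" .
  qed (use sum_powr_nonneg Q0 in auto)
  also have "\<dots> = Q (Suc (Suc m)) ^ (2 * Suc (Suc m))" by (simp flip: power_add)
  finally show ?case by (simp add: Q_def)
qed

text \<open>A real exponent lies between 2 and an even integer 2m, so \<open>L^r\<close> is
  controlled by those two norms. The even-power constants grow linearly, which gives a constant
  linear in \<open>r\<close>.\<close>

lemma sobolev_2d:
  assumes n: "n = 2" and v: "vanishing v" and CP: "0 \<le> CP"
    and poinc: "normL2 n a b h v \<le> CP * normD n a b h v" and r: "2 \<le> r"
  shows "normLp r v \<le> 4 * r * (1 + CP) * normD n a b h v"
proof -
  let ?D = "normD n a b h v"
  define m where "m = nat \<lceil>r / 2\<rceil>"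
  have m: "r \<le> 2 * real m" "real m \<le> r" "1 \<le> m"
    using r unfolding m_def by linarith+
  define M where "M = sqrt 2 * real m * (1 + CP) * ?D"
  have M0: "0 \<le> M" using CP normD_nonneg by (simp add: M_def)
  obtain k where k: "m = Suc k" using m by (cases m) auto
  have J2m: "(\<Sum>x\<in>B. \<bar>v x\<bar> powr (2 * real m) * H) \<le> M powr (2 * real m)"
    using sum_even_power_2d[OF n v CP poinc, of k] M0 powr_realpow'[of M "2 * m"]
    by (simp add: k M_def)
  have J2: "(\<Sum>x\<in>B. \<bar>v x\<bar> powr 2 * H) \<le> M powr 2"
  proof -
    have "(\<Sum>x\<in>B. \<bar>v x\<bar> powr 2 * H) \<le> (sqrt 2 * (1 + CP) * ?D)\<^sup>2"
      using sum_even_power_2d[OF n v CP poinc, of 0] by simp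
    also have "\<dots> \<le> M\<^sup>2"
      unfolding M_def using m CP normD_nonneg by (intro power_mono mult_right_mono) auto
    finally show ?thesis using M0 by simp
  qed
  have "normLp r v \<le> 2 powr (1 / r) * M"
  proof (rule normLp_leI)
    show "(\<Sum>x\<in>B. \<bar>v x\<bar> powr r * H) \<le> (2 powr (1 / r) * M) powr r"
    proof (cases "M = 0")
      case True
      then have "(\<Sum>x\<in>B. \<bar>v x\<bar> powr 2 * H) = 0"
        using J2 sum_powr_nonneg[of v 2] by simp
      then have "\<forall>x\<in>B. v x = 0"
        using finite_B H_pos by (subst (asm) sum_nonneg_eq_0_iff) auto
      then show ?thesis by simp
    next
      case False
      then have M: "0 < M" using M0 by simp
      \<comment> \<open>Applied to \<open>\<bar>v x\<bar> / M\<close>, this bounds the normalised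
        sum by 1 + 1, which accounts for the factor 2 inside the root.\<close>
      have pt: "t powr r \<le> t powr 2 + t powr (2 * real m)" if "0 \<le> t" for t :: real
      proof (cases "t \<le> 1")
        case True
        then have "t powr r \<le> t powr 2" using that r by (intro powr_mono') auto
        then show ?thesis by (simp add: add_increasing2)
      next
        case False
        then have "t powr r \<le> t powr (2 * real m)" using m by (intro powr_mono) auto
        then show ?thesis by (simp add: add_increasing)
      qed
      have "\<bar>v x\<bar> powr r * H \<le> M powr r * (\<bar>v x\<bar> powr 2 * H / M powr 2 + \<bar>v x\<bar> powr (2 * real m) * H / M powr (2 * real m))" for x
        using mult_left_mono[OF pt[of "\<bar>v x\<bar> / M"], of "M powr r * H"] M H_pos
        by (simp add: powr_divide field_simps)
      then have "(\<Sum>x\<in>B. \<bar>v x\<bar> powr r * H)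
         \<le> (\<Sum>x\<in>B. M powr r * (\<bar>v x\<bar> powr 2 * H / M powr 2 + \<bar>v x\<bar> powr (2 * real m) * H / M powr (2 * real m)))"
        by (rule sum_mono)
      also have "\<dots> = M powr r * ((\<Sum>x\<in>B. \<bar>v x\<bar> powr 2 * H) / M powr 2 + (\<Sum>x\<in>B. \<bar>v x\<bar> powr (2 * real m) * H) / M powr (2 * real m))"
        by (simp only: sum_distrib_left[symmetric] sum.distrib sum_divide_distrib[symmetric])
      also have "\<dots> \<le> M powr r * (1 + 1)"
        using J2 J2m M by (intro mult_left_mono add_mono) (auto simp: divide_le_eq)
      also have "\<dots> = (2 powr (1 / r) * M) powr r"
        using r by (simp add: powr_mult powr_powr)
      finally show ?thesis .
    qed
  qed (use r M0 in auto)
  \<comment> \<open>The final 4 r combines \<open>2 powr (1 / r) \<le> 2\<close>,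
    \<open>sqrt 2 \<le> 2\<close> and \<open>m \<le> r\<close>.\<close>
  also have "2 powr (1 / r) * M \<le> 2 * M"
    using r M0 powr_mono[of "1 / r" 1 2] by (intro mult_right_mono) auto
  also have "2 * M \<le> 2 * (2 * r * (1 + CP) * ?D)"
    unfolding M_def using m r CP normD_nonneg sqrt2_less_2 by (intro mult_left_mono mult_right_mono mult_mono) auto
  finally show ?thesis by (simp add: algebra_simps)
qed

subsection \<open>The a priori bound\<close>

text \<open>Stroock--Varopoulos on every mesh edge, then summation by parts. It replaces the chain
  rule, which fails for differences.\<close>

lemma energy_powr_le:
  assumes u: "vanishing u" and \<beta>: "1 \<le> \<beta>"
  shows "(normD n a b h (\<lambda>x. \<bar>u x\<bar> powr \<beta>))\<^sup>2
    \<le> \<beta> * (\<Sum>x\<in>B. - lap_h n h u x * (sgn (u x) * \<bar>u x\<bar> powr (2 * \<beta> - 1))) * H"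
proof -
  let ?w = "\<lambda>x. \<bar>u x\<bar> powr \<beta>" and ?\<phi> = "\<lambda>x. sgn (u x) * \<bar>u x\<bar> powr (2 * \<beta> - 1)"
  have w: "vanishing ?w" "vanishing ?\<phi>" using u by (auto simp: vanishing_def)
  have pt: "(Dplus h i ?w x)\<^sup>2 \<le> \<beta> * (Dplus h i u x * Dplus h i ?\<phi> x)" if i: "i < n" for i x
    using divide_right_mono[OF stroock_varopoulos[OF \<beta>, of "u (x(i := x i + h i))" "u x"], of "(h i)\<^sup>2"] h_pos[OF i]
    by (simp add: Dplus_def power_divide power2_eq_square)
  have "(normD n a b h ?w)\<^sup>2 = (\<Sum>i<n. \<Sum>x\<in>B. (Dplus h i ?w x)\<^sup>2 * H)"
    using normD_vanishing[OF w(1)] by (simp add: energy_def)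
  also have "\<dots> \<le> (\<Sum>i<n. \<Sum>x\<in>B. \<beta> * (Dplus h i u x * Dplus h i ?\<phi> x) * H)"
    using pt H_pos by (intro sum_mono mult_right_mono) auto
  also have "\<dots> = \<beta> * (\<Sum>i<n. \<Sum>x\<in>B. Dplus h i u x * Dplus h i ?\<phi> x) * H"
    by (simp add: sum_distrib_left sum_distrib_right)
  also have "\<dots> = \<beta> * (\<Sum>x\<in>B. - lap_h n h u x * ?\<phi> x) * H"
    using summation_by_parts[OF u w(2)] by simp
  finally show ?thesis .
qed

text \<open>Removes the dependence on \<beta> from the volume exponent 1/r below; this is the source
  of the factor 1 + |\<Omega>|.\<close>

lemma powr_vol_le:
  assumes "0 \<le> e" "e \<le> 1" "0 < V"
  shows "V powr e \<le> 1 + (V::real)"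
proof (cases "V \<le> 1")
  case True
  then have "V powr e \<le> 1" using assms by (intro powr_le1) auto
  then show ?thesis using assms by simp
next
  case False
  then have "V powr e \<le> V powr 1" using assms by (intro powr_mono) auto
  then show ?thesis using assms by simp
qed

text \<open>Hoelder against the constant 1 on the interior nodes. With \<open>s\<close> = 1/q the
  exponent \<open>r\<close> is 2q'\<beta>, and the volume appears to the power 1 - \<theta> = s +
  1/r.\<close>

lemma sum_low_power_le:
  fixes s \<beta> :: real
  assumes u: "vanishing u" and \<beta>: "1 \<le> \<beta>" and s: "0 \<le> s" "s < 1"
  defines "r \<equiv> 2 / (1 - s) * \<beta>" and "V \<equiv> box_vol n a b"
  shows "(\<Sum>x\<in>B. \<bar>u x\<bar> powr (2 * \<beta> - 1) * H) \<le> normLp r u powr (2 * \<beta> - 1) * (V powr s * (1 + V))"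
proof -
  define \<theta> where "\<theta> = (2 * \<beta> - 1) / r"
  have r: "2 \<le> r" 
  proof -
    have "2 / 1 \<le> 2 / (1 - s)" using s by (intro divide_left_mono) auto
    then show ?thesis using \<beta> s mult_mono[of 2 "2 / (1 - s)" 1 \<beta>] by (simp add: r_def)
  qed
  have rs: "r * (1 - s) = 2 * \<beta>" using s by (simp add: r_def)
  have \<theta>1: "1 - \<theta> = s + 1 / r"
  proof -
    have "\<theta> = (r * (1 - s) - 1) / r" unfolding \<theta>_def rs ..
    then show ?thesis using r by (simp add: field_simps)
  qed
  have "0 < s + 1 / r" using s r by (intro add_nonneg_pos) auto
  then have \<theta>: "0 < \<theta>" "\<theta> < 1" "r * \<theta> = 2 * \<beta> - 1"
    using \<beta> r unfolding \<theta>1[symmetric] by (auto simp: \<theta>_def)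
  have V: "0 < V" using box_vol_pos by (simp add: V_def)
  have W: "(\<Sum>x\<in>W. F x * H) = (\<Sum>x\<in>B. F x * H)" if "\<And>x. x \<notin> W \<Longrightarrow> F x = 0" for F :: "_ \<Rightarrow> real"
    using that finite_B W_subset_B by (intro sum.mono_neutral_left) auto
  have "(\<Sum>x\<in>B. \<bar>u x\<bar> powr (2 * \<beta> - 1) * H) = (\<Sum>x\<in>W. \<bar>u x\<bar> powr (2 * \<beta> - 1) * H)"
    using u by (intro W[symmetric]) (auto simp: vanishing_def)
  also have "\<dots> = (\<Sum>x\<in>W. (\<bar>u x\<bar> powr r * H) powr \<theta> * H powr (1 - \<theta>))"
  proof (intro sum.cong refl)
    have "H powr \<theta> * H powr (1 - \<theta>) = H" using H_pos by (simp flip: powr_add)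
    then show "\<bar>u x\<bar> powr (2 * \<beta> - 1) * H = (\<bar>u x\<bar> powr r * H) powr \<theta> * H powr (1 - \<theta>)" for x
      unfolding powr_mult powr_powr \<theta>(3) by (simp add: mult.assoc)
  qed
  also have "\<dots> \<le> (\<Sum>x\<in>W. \<bar>u x\<bar> powr r * H) powr \<theta> * (\<Sum>x\<in>W. H) powr (1 - \<theta>)"
    using H_pos \<theta> finite_subset[OF W_subset_B finite_B] by (intro holder_sum) auto
  also have "(\<Sum>x\<in>W. \<bar>u x\<bar> powr r * H) = (\<Sum>x\<in>B. \<bar>u x\<bar> powr r * H)"
    using u by (intro W) (auto simp: vanishing_def)
  also have "(\<Sum>x\<in>B. \<bar>u x\<bar> powr r * H) powr \<theta> = normLp r u powr (2 * \<beta> - 1)"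
    using r by (simp add: normLp_powr \<theta>_def)
  also have "normLp r u powr (2 * \<beta> - 1) * (\<Sum>x\<in>W. H) powr (1 - \<theta>) \<le> normLp r u powr (2 * \<beta> - 1) * (V powr s * (1 + V))"
  proof (rule mult_left_mono)
    have "(\<Sum>x\<in>W. H) powr (1 - \<theta>) \<le> V powr (1 - \<theta>)"
      unfolding V_def using \<theta> H_pos volume_bound by (intro powr_mono2) (auto intro: sum_nonneg)
    also have "\<dots> = V powr s * V powr (1 / r)" unfolding \<theta>1 by (rule powr_add)
    also have "\<dots> \<le> V powr s * (1 + V)"
      using r V by (intro mult_left_mono powr_vol_le) auto
    finally show "(\<Sum>x\<in>W. H) powr (1 - \<theta>) \<le> V powr s * (1 + V)" .
  qed simp
  finally show ?thesis .
qed

lemma normLp_abs_powr: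
  assumes "0 < \<tau>" "0 < \<beta>"
  shows "normLp \<tau> (\<lambda>x. \<bar>u x\<bar> powr \<beta>) = normLp (\<tau> * \<beta>) u powr \<beta>"
  using assms by (simp add: normLp_def powr_powr mult.commute[of \<tau>])

text \<open>The growth condition splits the tested equation into a potential term, measured by
  \<open>E\<close>, and a lower-order term from \<open>C3\<close>. The Sobolev inequality for
  \<open>\<bar>u x\<bar> powr \<beta>\<close> converts the energy bound into higher
  integrability.\<close>

lemma moser_step:
  fixes s \<beta> \<tau> S E p C2 C3 :: real
  assumes u: "vanishing u" and \<beta>: "1 \<le> \<beta>" and s: "0 \<le> s" "s < 1" and \<tau>: "0 < \<tau>"
    and C2: "0 < C2" and C3: "0 < C3" and S: "0 \<le> S" and E: "0 \<le> E"
    and lap: "\<And>x. x \<in> W \<Longrightarrow> \<bar>lap_h n h u x\<bar> \<le> C2 * \<bar>u x\<bar> powr p + C3"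
    and sob: "\<And>v. vanishing v \<Longrightarrow> normLp \<tau> v \<le> S * normD n a b h v"
    and pot: "(\<Sum>x\<in>B. \<bar>u x\<bar> powr (p - 1 + 2 * \<beta>) * H) \<le> E * normLp (2 / (1 - s) * \<beta>) u powr (2 * \<beta>)"
  shows "normLp (\<tau> * \<beta>) u
    \<le> (S * sqrt (C2 * E + box_vol n a b powr s) * \<beta>) powr (1 / \<beta>)
       * max (normLp (2 / (1 - s) * \<beta>) u) (C3 * (1 + box_vol n a b))"
proof -
  let ?V = "box_vol n a b" and ?w = "\<lambda>x. \<bar>u x\<bar> powr \<beta>"
  define M where "M = normLp (2 / (1 - s) * \<beta>) u"
  define N where "N = max M (C3 * (1 + ?V))"
  define Q where "Q = C2 * E + ?V powr s"
  have V: "0 < ?V" by (rule box_vol_pos)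
  have M: "0 \<le> M" "M \<le> N" by (auto simp: M_def N_def normLp_nonneg)
  have "0 < C3 * (1 + ?V)" using C3 V by simp
  then have N: "0 < N" "C3 * (1 + ?V) \<le> N" by (auto simp: N_def)
  have Q: "0 \<le> Q" using C2 E by (simp add: Q_def)
  have w: "vanishing ?w" using u by (simp add: vanishing_def)
  have "(\<Sum>x\<in>B. - lap_h n h u x * (sgn (u x) * \<bar>u x\<bar> powr (2 * \<beta> - 1)))
      \<le> (\<Sum>x\<in>B. (C2 * \<bar>u x\<bar> powr p + C3) * \<bar>u x\<bar> powr (2 * \<beta> - 1))"
  proof (rule sum_mono)
    fix x
    show "- lap_h n h u x * (sgn (u x) * \<bar>u x\<bar> powr (2 * \<beta> - 1))
      \<le> (C2 * \<bar>u x\<bar> powr p + C3) * \<bar>u x\<bar> powr (2 * \<beta> - 1)"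
    proof (cases "x \<in> W")
      case True
      have "- lap_h n h u x * sgn (u x) \<le> \<bar>lap_h n h u x\<bar>"
        by (auto simp: sgn_if abs_ge_minus_self)
      then have "- lap_h n h u x * sgn (u x) \<le> C2 * \<bar>u x\<bar> powr p + C3"
        using lap[OF True] by linarith
      from mult_right_mono[OF this, of "\<bar>u x\<bar> powr (2 * \<beta> - 1)"] show ?thesis by (simp add: mult.assoc)
    next
      case False
      then show ?thesis using u by (simp add: vanishing_def)
    qed
  qed
  then have "(\<Sum>x\<in>B. - lap_h n h u x * (sgn (u x) * \<bar>u x\<bar> powr (2 * \<beta> - 1))) * H
      \<le> (\<Sum>x\<in>B. (C2 * \<bar>u x\<bar> powr p + C3) * \<bar>u x\<bar> powr (2 * \<beta> - 1)) * H"
    using H_pos by (intro mult_right_mono) auto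
  also have "\<dots> = C2 * (\<Sum>x\<in>B. \<bar>u x\<bar> powr (p - 1 + 2 * \<beta>) * H) + C3 * (\<Sum>x\<in>B. \<bar>u x\<bar> powr (2 * \<beta> - 1) * H)"
  proof -
    have e: "y powr (p - 1 + 2 * \<beta>) = y powr p * y powr (2 * \<beta> - 1)" for y :: real
      by (simp add: algebra_simps flip: powr_add)
    have "(C2 * y powr p + C3) * y powr (2 * \<beta> - 1) * H
        = C2 * (y powr (p - 1 + 2 * \<beta>) * H) + C3 * (y powr (2 * \<beta> - 1) * H)" for y :: real
      unfolding e by (simp add: distrib_right)
    then show ?thesis
      unfolding sum_distrib_right sum_distrib_left sum.distrib[symmetric] by (intro sum.cong refl)
  qed
  also have "\<dots> \<le> C2 * (E * N powr (2 * \<beta>)) + ?V powr s * N powr (2 * \<beta>)"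
  proof (rule add_mono)
    have "E * M powr (2 * \<beta>) \<le> E * N powr (2 * \<beta>)"
      using M E \<beta> by (intro mult_left_mono powr_mono2) auto
    then show "C2 * (\<Sum>x\<in>B. \<bar>u x\<bar> powr (p - 1 + 2 * \<beta>) * H) \<le> C2 * (E * N powr (2 * \<beta>))"
      using pot C2 by (intro mult_left_mono) (auto simp: M_def)
    have "C3 * (\<Sum>x\<in>B. \<bar>u x\<bar> powr (2 * \<beta> - 1) * H) \<le> C3 * (M powr (2 * \<beta> - 1) * (?V powr s * (1 + ?V)))"
      using sum_low_power_le[OF u \<beta> s] C3 unfolding M_def by (intro mult_left_mono) auto
    \<comment> \<open>The constant \<open>C3 * (1 + ?V)\<close> supplies the missing power of
      \<open>N\<close>, so the lower-order term becomes homogeneous of degree 2\<beta>; this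
      dictates the floor in the maximum.\<close>
    also have "\<dots> = ?V powr s * (M powr (2 * \<beta> - 1) * (C3 * (1 + ?V)))" by (simp add: mult_ac)
    also have "\<dots> \<le> ?V powr s * (N powr (2 * \<beta> - 1) * N)"
      using M N \<beta> C3 V by (intro mult_left_mono mult_mono powr_mono2) auto
    also have "N powr (2 * \<beta> - 1) * N = N powr (2 * \<beta>)"
      using N by (simp add: powr_diff)
    finally show "C3 * (\<Sum>x\<in>B. \<bar>u x\<bar> powr (2 * \<beta> - 1) * H) \<le> ?V powr s * N powr (2 * \<beta>)" .
  qed
  also have "\<dots> = Q * N powr (2 * \<beta>)" by (simp add: Q_def algebra_simps)
  finally have "\<beta> * ((\<Sum>x\<in>B. - lap_h n h u x * (sgn (u x) * \<bar>u x\<bar> powr (2 * \<beta> - 1))) * H) \<le> \<beta> * (Q * N powr (2 * \<beta>))"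
    using \<beta> by (intro mult_left_mono) auto
  then have "(normD n a b h ?w)\<^sup>2 \<le> \<beta> * (Q * N powr (2 * \<beta>))"
    using energy_powr_le[OF u \<beta>] by (simp add: mult.assoc)
  \<comment> \<open>Weakening \<beta> to its square makes the root linear in \<beta>, the form that
    \<open>moser_iteration\<close> expects.\<close>
  also have "\<dots> \<le> \<beta>\<^sup>2 * (Q * N powr (2 * \<beta>))"
    using \<beta> Q by (intro mult_right_mono) (auto simp: power2_eq_square)
  also have "\<dots> = (sqrt Q * \<beta> * N powr \<beta>)\<^sup>2"
    using Q by (simp add: power_mult_distrib power2_eq_square[of "N powr \<beta>"] flip: powr_add)
  finally have "normD n a b h ?w \<le> sqrt Q * \<beta> * N powr \<beta>"
    using Q \<beta> by (intro power2_le_imp_le[of "normD n a b h ?w"]) auto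
  then have "S * normD n a b h ?w \<le> S * (sqrt Q * \<beta> * N powr \<beta>)"
    using S by (rule mult_left_mono)
  then have "normLp (\<tau> * \<beta>) u powr \<beta> \<le> S * sqrt Q * \<beta> * N powr \<beta>"
    using sob[OF w] normLp_abs_powr[OF \<tau>, of \<beta> u] \<beta> by (simp add: mult.assoc)
  then have "(normLp (\<tau> * \<beta>) u powr \<beta>) powr (1 / \<beta>) \<le> (S * sqrt Q * \<beta> * N powr \<beta>) powr (1 / \<beta>)"
    using \<beta> by (intro powr_mono2) auto
  then show ?thesis
    using \<beta> N normLp_nonneg[of "\<tau> * \<beta>" u] by (simp add: powr_powr powr_mult Q_def N_def M_def)
qed

text \<open>All but two of the \<kappa> powers of \<open>\<bar>u x\<bar>\<close> are replaced by the
  maximum; since 2/\<kappa> = 1 - s, the root distributes the exponents as s and 1 - s.\<close>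

lemma normLp_interpolation:
  fixes s :: real
  assumes s: "0 \<le> s" "s < 1"
  shows "normLp (2 / (1 - s)) u \<le> normInf n a b h u powr s * normL2 n a b h u powr (1 - s)"
proof -
  define \<kappa> where "\<kappa> = 2 / (1 - s)"
  let ?X = "normInf n a b h u"
  have \<kappa>: "2 \<le> \<kappa>" "2 / \<kappa> = 1 - s"
    using s by (auto simp: \<kappa>_def divide_simps)
  have le: "\<bar>u x\<bar> \<le> ?X" if "x \<in> B" for x
    unfolding normInf_def using finite_B that by (intro Max_ge) auto
  have "(\<Sum>x\<in>B. \<bar>u x\<bar> powr \<kappa> * H) \<le> (\<Sum>x\<in>B. ?X powr (\<kappa> - 2) * ((u x)\<^sup>2 * H))"
  proof (rule sum_mono)
    fix x assume x: "x \<in> B"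
    have "\<bar>u x\<bar> powr \<kappa> = \<bar>u x\<bar> powr (\<kappa> - 2) * (u x)\<^sup>2"
      by (cases "u x = 0") (auto simp: powr_diff)
    also have "\<dots> \<le> ?X powr (\<kappa> - 2) * (u x)\<^sup>2"
      using le[OF x] \<kappa> by (intro mult_right_mono powr_mono2) auto
    finally show "\<bar>u x\<bar> powr \<kappa> * H \<le> ?X powr (\<kappa> - 2) * ((u x)\<^sup>2 * H)"
      using H_pos by (simp flip: mult.assoc)
  qed
  also have "\<dots> = ?X powr (\<kappa> - 2) * (normL2 n a b h u)\<^sup>2"
    using H_pos by (simp add: normL2_def sum_nonneg sum_distrib_left)
  finally have "normLp \<kappa> u \<le> (?X powr (\<kappa> - 2) * (normL2 n a b h u)\<^sup>2) powr (1 / \<kappa>)"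
    unfolding normLp_def using \<kappa> sum_powr_nonneg by (intro powr_mono2) auto
  also have "\<dots> = ?X powr s * normL2 n a b h u powr (1 - s)"
  proof -
    have L0: "0 \<le> normL2 n a b h u"
      unfolding normL2_def using H_pos by (intro real_sqrt_ge_zero sum_nonneg) auto
    have "(\<kappa> - 2) / \<kappa> = s" using \<kappa> by (simp add: diff_divide_distrib)
    then show ?thesis
      using \<kappa> L0 by (simp add: powr_mult powr_powr flip: powr_numeral)
  qed
  finally show ?thesis by (simp add: \<kappa>_def)
qed

text \<open>Common to both dimensions, with \<open>s\<close> = 1/q, \<tau> the Sobolev exponent and
  \<rho> = \<tau>/(2q'). \<open>K\<close> is only required to dominate the iteration constant, so
  that the explicit constants of the theorem can be inserted.\<close>

lemma sup_bound:
  fixes s \<tau> S E p C2 C3 K Y :: real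
  defines "\<rho> \<equiv> \<tau> * (1 - s) / 2"
  assumes u: "vanishing u" and s: "0 \<le> s" "s < 1" and \<rho>: "1 < \<rho>"
    and C2: "0 < C2" and C3: "0 < C3" and S: "0 \<le> S" and E: "0 \<le> E"
    and lap: "\<And>x. x \<in> W \<Longrightarrow> \<bar>lap_h n h u x\<bar> \<le> C2 * \<bar>u x\<bar> powr p + C3"
    and sob: "\<And>v. vanishing v \<Longrightarrow> normLp \<tau> v \<le> S * normD n a b h v"
    and pot: "\<And>\<beta>. 1 \<le> \<beta> \<Longrightarrow> (\<Sum>x\<in>B. \<bar>u x\<bar> powr (p - 1 + 2 * \<beta>) * H) \<le> E * normLp (2 / (1 - s) * \<beta>) u powr (2 * \<beta>)"
    and K: "max \<rho> (S * sqrt (C2 * E + box_vol n a b powr s)) powr ((\<rho> / (\<rho> - 1))\<^sup>2) \<le> K"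
    and Y: "normL2 n a b h u \<le> Y"
  shows "normInf n a b h u \<le> (2 * K) powr (1 / (1 - s)) * Y + 2 * K * C3 * (1 + box_vol n a b)"
proof -
  let ?X = "normInf n a b h u" and ?V = "box_vol n a b" and ?L2 = "normL2 n a b h u"
  define C where "C = S * sqrt (C2 * E + ?V powr s)"
  define \<kappa> where "\<kappa> = 2 / (1 - s)"
  have V: "0 < ?V" by (rule box_vol_pos)
  have \<kappa>: "0 < \<kappa>" "\<rho> * \<kappa> = \<tau>" using s by (auto simp: \<kappa>_def \<rho>_def)
  then have \<tau>: "0 < \<tau>" using \<rho> by (metis mult_pos_pos less_trans zero_less_one)
  have k: "0 \<le> C3 * (1 + ?V)" using C3 V by simp
  have C: "0 \<le> C" unfolding C_def using S E C2 by simp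
  have K0: "0 < max \<rho> C powr ((\<rho> / (\<rho> - 1))\<^sup>2)" using \<rho> by (auto simp: max_def)
  have Kp: "0 < K" using K K0 unfolding C_def by linarith
  have bound: "\<bar>u x\<bar> \<le> max \<rho> C powr ((\<rho> / (\<rho> - 1))\<^sup>2) * max (normLp \<kappa> u) (C3 * (1 + ?V))" if "x \<in> B" for x
    unfolding normLp_def
  proof (rule moser_iteration[OF finite_B H_pos \<kappa>(1) \<rho> C k _ that], fold normLp_def)
    show "normLp (\<rho> * \<kappa> * \<beta>) u \<le> (C * \<beta>) powr (1 / \<beta>) * max (normLp (\<kappa> * \<beta>) u) (C3 * (1 + ?V))"
      if "1 \<le> \<beta>" for \<beta>
      unfolding \<kappa>(2) C_def
      using moser_step[OF u that s \<tau> C2 C3 S E lap sob pot[OF that]] by (simp add: \<kappa>_def)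
  qed
  have Bne: "B \<noteq> {}" using W_nonempty W_subset_B by auto
  have "?X \<le> max \<rho> C powr ((\<rho> / (\<rho> - 1))\<^sup>2) * max (normLp \<kappa> u) (C3 * (1 + ?V))"
    unfolding normInf_def[of n a b h u] using bound finite_B Bne by (subst Max_le_iff) auto
  also have "\<dots> \<le> K * (?X powr s * ?L2 powr (1 - s) + C3 * (1 + ?V))"
  proof (rule mult_mono)
    show "max \<rho> C powr ((\<rho> / (\<rho> - 1))\<^sup>2) \<le> K" using K by (simp add: C_def)
    show "max (normLp \<kappa> u) (C3 * (1 + ?V)) \<le> ?X powr s * ?L2 powr (1 - s) + C3 * (1 + ?V)"
      using normLp_interpolation[OF s, of u] k by (simp add: \<kappa>_def add_increasing add_increasing2)
    show "0 \<le> K" using Kp by simp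
    show "0 \<le> max (normLp \<kappa> u) (C3 * (1 + ?V))" using k by simp
  qed
  finally have X: "?X \<le> K * (?X powr s * ?L2 powr (1 - s) + C3 * (1 + ?V))" .
  have X0: "0 \<le> ?X"
  proof -
    obtain x where "x \<in> B" using Bne by auto
    then have "\<bar>u x\<bar> \<le> ?X" unfolding normInf_def using finite_B by (intro Max_ge) auto
    then show ?thesis by linarith
  qed
  have L0: "0 \<le> ?L2" unfolding normL2_def using H_pos by (intro real_sqrt_ge_zero sum_nonneg) auto
  have "?X \<le> (2 * K) powr (1 / (1 - s)) * ?L2 + 2 * K * (C3 * (1 + ?V))"
    by (rule absorb_power[OF s X0 L0 Kp k X])
  also have "(2 * K) powr (1 / (1 - s)) * ?L2 \<le> (2 * K) powr (1 / (1 - s)) * Y"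
    using Y by (intro mult_left_mono) auto
  finally show ?thesis by (simp add: mult.assoc)
qed

text \<open>Hoelder with exponents q and q': the factor with exponent p - 1 is put in the norm of
  order q(p - 1), the factor with exponent 2\<beta> in the norm of order 2q'\<beta>.\<close>

lemma potential_bound:
  fixes p q \<beta> A :: real
  assumes p: "1 < p" and q: "1 < q" and \<beta>: "1 \<le> \<beta>" and A: "normLp (q * (p - 1)) u \<le> A"
  shows "(\<Sum>x\<in>B. \<bar>u x\<bar> powr (p - 1 + 2 * \<beta>) * H)
    \<le> A powr (p - 1) * normLp (2 / (1 - 1 / q) * \<beta>) u powr (2 * \<beta>)"
proof -
  define s where "s = 1 / q"
  define r where "r = 2 / (1 - s) * \<beta>"
  have s: "0 < s" "s < 1" "q * s = 1" using q by (auto simp: s_def)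
  have r: "0 < r" "r * (1 - s) = 2 * \<beta>" using s \<beta> by (auto simp: r_def)
  have rs: "2 * \<beta> / r = 1 - s" using r by (simp add: field_simps)
  have qp: "0 < q * (p - 1)" "(p - 1) / (q * (p - 1)) = s" "q * (p - 1) * s = p - 1"
    using p q s by (auto simp: s_def)
  have "(\<Sum>x\<in>B. \<bar>u x\<bar> powr (p - 1 + 2 * \<beta>) * H)
      = (\<Sum>x\<in>B. (\<bar>u x\<bar> powr (q * (p - 1)) * H) powr s * (\<bar>u x\<bar> powr r * H) powr (1 - s))"
  proof (rule sum.cong)
    fix x
    have "H powr s * H powr (1 - s) = H" using H_pos by (simp flip: powr_add)
    then show "\<bar>u x\<bar> powr (p - 1 + 2 * \<beta>) * H
      = (\<bar>u x\<bar> powr (q * (p - 1)) * H) powr s * (\<bar>u x\<bar> powr r * H) powr (1 - s)"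
      unfolding powr_mult powr_powr qp(3) r(2) powr_add by (simp add: mult_ac)
  qed simp
  also have "\<dots> \<le> (\<Sum>x\<in>B. \<bar>u x\<bar> powr (q * (p - 1)) * H) powr s * (\<Sum>x\<in>B. \<bar>u x\<bar> powr r * H) powr (1 - s)"
    using s H_pos finite_B by (intro holder_sum) auto
  also have "\<dots> = normLp (q * (p - 1)) u powr (p - 1) * normLp r u powr (2 * \<beta>)"
    using qp r rs by (simp add: normLp_powr)
  also have "\<dots> \<le> A powr (p - 1) * normLp r u powr (2 * \<beta>)"
    using A p by (intro mult_right_mono powr_mono2) (auto simp: normLp_nonneg)
  finally show ?thesis by (simp add: r_def s_def)
qed

section \<open>Positivity of the Poincare constant and extension by zero\<close>

text \<open>Test the Poincare inequality with the indicator function of one interior node.\<close>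

lemma poincare_const_pos:
  assumes "\<And>v. v \<in> W0 n a b h \<Longrightarrow> normL2 n a b h v \<le> CP * normD n a b h v"
  shows "0 < CP"
proof -
  obtain y where y: "y \<in> W" using W_nonempty by auto
  define v where "v x = (if x = y then 1 else 0 :: real)" for x
  have "v \<in> W0 n a b h"
    using y by (auto simp: W0_def v_def simp flip: B_minus_W)
  then have le: "normL2 n a b h v \<le> CP * normD n a b h v" by (rule assms)
  have "(v y)\<^sup>2 * H \<le> (\<Sum>x\<in>B. (v x)\<^sup>2 * H)"
    using H_pos finite_B y W_subset_B by (intro member_le_sum) auto
  then have "0 < normL2 n a b h v"
    unfolding normL2_def using H_pos by (auto simp: v_def)
  then show ?thesis
    using le normD_nonneg[of v] by (metis mult_nonpos_nonneg not_le order_less_le_trans)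
qed

text \<open>The values of \<open>u\<close> away from the mesh are arbitrary. Setting them to zero
  changes nothing relevant, because the norms, and the Laplacian at interior nodes, evaluate
  \<open>u\<close> only on \<open>B\<close>.\<close>

lemma zero_extension:
  assumes u: "u \<in> W0 n a b h"
  defines "v \<equiv> \<lambda>x. if x \<in> W then u x else 0"
  shows "vanishing v" "normInf n a b h v = normInf n a b h u" "normL2 n a b h v = normL2 n a b h u"
    "normD n a b h v = normD n a b h u" "\<And>x. x \<in> W \<Longrightarrow> lap_h n h v x = lap_h n h u x"
    "\<And>x. x \<in> B \<Longrightarrow> v x = u x"
proof -
  show eq: "v x = u x" if "x \<in> B" for x
    using u that by (auto simp: v_def W0_def simp flip: B_minus_W)
  show "vanishing v" by (simp add: vanishing_def v_def)
  show "normInf n a b h v = normInf n a b h u"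
    unfolding normInf_def using eq by (metis (no_types, lifting) image_cong)
  show "normL2 n a b h v = normL2 n a b h u"
    unfolding normL2_def using eq by simp
  show "lap_h n h v x = lap_h n h u x" if x: "x \<in> W" for x
    unfolding lap_h_def using neighbours_in_B[OF x] eq x W_subset_B
    by (intro sum.cong) (auto simp: shift_def)
  have "Dplus h i v x = Dplus h i u x" if i: "i < n" and x: "x \<in> B - dOmega_plus_h n a b h i" for i x
  proof -
    obtain K L :: int where KL: "a i = of_int K * h i" "b i = of_int L * h i" "h i > 0"
      using mesh_ints i by metis
    have xi: "x i \<noteq> b i"
      using x i unfolding dOmega_plus_h_def B_minus_W[symmetric] by (auto simp: Omega_h_def open_box_def)
    have "x i \<in> (\<lambda>z. h i * of_int z) ` {K..L}"
      using x i by (simp add: B_eq flip: nodes_eq[OF i KL])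
    then obtain z where z: "K \<le> z" "z \<le> L" "x i = h i * of_int z" by auto
    then have "z \<noteq> L" using xi KL by (auto simp: mult.commute)
    then have "h i * of_int (z + 1) \<in> nodes i"
      unfolding nodes_eq[OF i KL] using z by (intro imageI) auto
    then have "x(i := x i + h i) \<in> B"
      using x z i by (auto simp: B_eq algebra_simps)
    then show ?thesis using x eq by (simp add: Dplus_def)
  qed
  then show "normD n a b h v = normD n a b h u"
    unfolding normD_def by simp
qed

end

section \<open>Exponent arithmetic and the explicit constants in each dimension\<close>

text \<open>Everything is expressed through \<open>s\<close> = 1/q, so that \<open>p = 1\<close> is
  the regular value s = 0. Subcriticality of \<open>p\<close> is equivalent to n s < 2, which in
  turn is \<rho> > 1.\<close>

lemma exponents3:
  fixes n :: nat and p :: real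
  assumes n: "3 \<le> n" and p: "1 \<le> p" "p < (real n + 2) / (real n - 2)"
  defines "s \<equiv> inv_q3 n p" and "\<rho> \<equiv> 2 * real n / (real n - 2) * (1 - inv_q3 n p) / 2"
  shows "0 \<le> s" "s < 1" "1 < \<rho>" "q3' n p = 1 / (1 - s)" "expo3 n p = \<rho> / (\<rho> - 1)"
    "real n / ((real n - 2) * q3' n p) = \<rho>"
proof -
  have n3: "3 \<le> real n" using n by simp
  have s: "s = (real n - 2) * (p - 1) / (2 * real n)"
    using p n3 by (auto simp: s_def inv_q3_def q3_def)
  have pn: "(real n - 2) * (p - 1) < 4"
    using p n3 by (simp add: pos_less_divide_eq algebra_simps)
  show s0: "0 \<le> s" unfolding s using p n3 by simp
  have ns: "real n * s < 2" unfolding s using pn n3 by simp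
  then show s1: "s < 1" using n3 s0 mult_right_mono[of 2 "real n" s] by simp
  have \<rho>: "\<rho> = real n * (1 - s) / (real n - 2)"
    unfolding \<rho>_def s_def using n3 by (simp add: divide_simps)
  then show \<rho>1: "1 < \<rho>" using ns n3 by (simp add: less_divide_eq algebra_simps)
  show q': "q3' n p = 1 / (1 - s)"
  proof (cases "p = 1")
    case False
    then have q: "s = 1 / q3 n p" by (simp add: s_def inv_q3_def)
    have "s \<noteq> 0" unfolding s using False n3 by simp
    have q3: "q3 n p = 1 / s" using q by simp
    show ?thesis unfolding q3'_def q3 using False \<open>s \<noteq> 0\<close> s1 by (simp add: divide_simps)
  qed (simp add: q3'_def s_def inv_q3_def)
  show "real n / ((real n - 2) * q3' n p) = \<rho>"
    unfolding q' \<rho> by simp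
  have e: "\<rho> / (\<rho> - 1) = real n * (1 - s) / (2 - real n * s)"
    unfolding \<rho> using n3 ns by (simp add: divide_simps) (simp add: algebra_simps)
  show "expo3 n p = \<rho> / (\<rho> - 1)"
  proof (cases "p = 1")
    case True
    then show ?thesis unfolding e by (simp add: expo3_def s_def inv_q3_def)
  next
    case False
    then have q: "s = 1 / q3 n p" by (simp add: s_def inv_q3_def)
    have "s \<noteq> 0" unfolding s using False n3 by simp
    have q3: "q3 n p = 1 / s" using q by simp
    show ?thesis unfolding e expo3_def q3 using False \<open>s \<noteq> 0\<close> ns
      by (simp add: divide_simps)
  qed
qed

text \<open>This lets \<open>2 * C_S 2\<close> dominate the factor 4 produced by
  \<open>sobolev_2d\<close>.\<close>

lemma C_S_2_ge: "2 \<le> C_S 2"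
proof -
  have "1 \<le> 2 * pi * (exp 1 + 256 :: real)"
    using pi_gt3 mult_mono[of 1 "2 * pi" 1 "exp 1 + 256 :: real"] by (simp add: add_increasing)
  then have "1 \<le> sqrt (2 * pi * (exp 1 + 256 :: real))" by (rule real_sqrt_ge_one)
  then show ?thesis unfolding C_S_def if_P[OF refl] by linarith
qed

context box_mesh
begin

text \<open>The exponent \<open>q3 n p\<close> is chosen so that q(p - 1) equals the Sobolev
  exponent 2n/(n-2); hence \<open>sobolev\<close> bounds the potential by the energy norm.\<close>

lemma sup_bound_dim_ge_3:
  assumes n: "3 \<le> n" and p: "1 \<le> p" "p < (real n + 2) / (real n - 2)"
    and C2: "0 < C2" and C3: "0 < C3" and u: "vanishing u"
    and lap: "\<And>x. x \<in> W \<Longrightarrow> \<bar>lap_h n h u x\<bar> \<le> C2 * \<bar>u x\<bar> powr p + C3"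
    and Y: "normL2 n a b h u \<le> Y"
  defines "K \<equiv> K3 n p C2 (normD n a b h u) (box_vol n a b)"
  shows "normInf n a b h u \<le> (2 * K) powr (q3' n p) * Y + 2 * K * C3 * (1 + box_vol n a b)"
proof -
  let ?D = "normD n a b h u" and ?V = "box_vol n a b" and ?\<tau> = "2 * real n / (real n - 2)"
  define s where "s = inv_q3 n p"
  define E where "E = pow0 (C_S n) (p - 1) * pow0 ?D (p - 1)"
  note ex = exponents3[OF n p, folded s_def]
  have C0: "0 \<le> C_S n" using n by (simp add: C_S_def)
  have E0: "0 \<le> E" by (simp add: E_def pow0_def)
  have V: "0 < ?V" by (rule box_vol_pos)
  have pot: "(\<Sum>x\<in>B. \<bar>u x\<bar> powr (p - 1 + 2 * \<beta>) * H) \<le> E * normLp (2 / (1 - s) * \<beta>) u powr (2 * \<beta>)"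
    if \<beta>: "1 \<le> \<beta>" for \<beta>
  proof (cases "p = 1")
    \<comment> \<open>For \<open>p = 1\<close> both \<open>pow0\<close> factors are 1 and s = 0, so
      the potential estimate is an identity.\<close>
    case True
    then show ?thesis using \<beta> normLp_powr_self[of "2 * \<beta>" u]
      by (simp add: E_def pow0_def s_def inv_q3_def)
  next
    case False
    then have p1: "1 < p" using p by simp
    have s: "s = 1 / q3 n p" using False by (simp add: s_def inv_q3_def)
    have q: "0 < q3 n p" using n p1 by (simp add: q3_def)
    then have q1: "1 < q3 n p" using ex(2) by (simp add: s)
    have "q3 n p * (p - 1) = ?\<tau>" using p1 by (simp add: q3_def)
    then have "normLp (q3 n p * (p - 1)) u \<le> C_S n * ?D" using sobolev[OF n u] by simp
    from potential_bound[OF p1 q1 \<beta> this] show ?thesis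
      using False by (simp add: E_def pow0_def s powr_mult)
  qed
  have "C_S n * sqrt (C2 * E + ?V powr s) \<le> C_S n * sqrt 2 * sqrt (C2 * E + ?V powr s)"
    using C0 C2 E0 by (intro mult_right_mono mult_left_mono) (auto simp: mult_le_cancel_left1)
  then have "max (?\<tau> * (1 - s) / 2) (C_S n * sqrt (C2 * E + ?V powr s))
      \<le> max (?\<tau> * (1 - s) / 2) (C_S n * sqrt 2 * sqrt (C2 * E + ?V powr s))" by simp
  then have K: "max (?\<tau> * (1 - s) / 2) (C_S n * sqrt (C2 * E + ?V powr s))
      powr ((?\<tau> * (1 - s) / 2 / (?\<tau> * (1 - s) / 2 - 1))\<^sup>2) \<le> K"
    unfolding K_def K3_def ex(5,6) E_def s_def[symmetric] mult.assoc[of C2]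
    using ex(3) by (intro powr_mono2) auto
  show ?thesis
    unfolding ex(4)
    by (rule sup_bound[OF u ex(1,2,3) C2 C3 C0 E0 lap sobolev[OF n] pot K Y])
qed

text \<open>In dimension 2 every finite exponent is available. The number \<open>nh\<close> acts as
  a fictitious dimension with Sobolev exponent \<tau> = 2nh/(nh-2), and nh/2 < q yields \<rho> >
  1.\<close>

lemma sup_bound_dim_2:
  assumes n: "n = 2" and p: "1 \<le> p" and q: "1 < q" "2 < q * (p - 1)" "nh / 2 < q" "1 < nh / 2"
    and C2: "0 < C2" and C3: "0 < C3" and u: "vanishing u"
    and lap: "\<And>x. x \<in> W \<Longrightarrow> \<bar>lap_h n h u x\<bar> \<le> C2 * \<bar>u x\<bar> powr p + C3"
    and CP: "0 \<le> CP" and poinc: "\<And>v. vanishing v \<Longrightarrow> normL2 n a b h v \<le> CP * normD n a b h v"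
  defines "K \<equiv> K2 q nh p C2 CP (normD n a b h u) (box_vol n a b)"
  shows "normInf n a b h u \<le> (2 * K) powr (q / (q - 1)) * (CP * normD n a b h u) + 2 * K * C3 * (1 + box_vol n a b)"
proof -
  let ?D = "normD n a b h u" and ?V = "box_vol n a b"
  define s where "s = 1 / q"
  define \<tau> where "\<tau> = 2 * nh / (nh - 2)"
  define \<rho> where "\<rho> = \<tau> * (1 - s) / 2"
  define T where "T = 2 * C_S 2 * (1 + CP) * q * (p - 1)"
  define S where "S = 4 * \<tau> * (1 + CP)"
  define A where "A = 4 * (q * (p - 1)) * (1 + CP) * ?D"
  have p1: "1 < p" using p q by (cases "p = 1") auto
  have s: "0 \<le> s" "s < 1" "1 / (1 - s) = q / (q - 1)" using q by (auto simp: s_def divide_simps)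
  have \<tau>: "2 \<le> \<tau>" using q by (simp add: \<tau>_def le_divide_eq)
  have \<rho>: "nh / ((nh - 2) * (q / (q - 1))) = \<rho>"
    using q by (simp add: \<rho>_def \<tau>_def s_def divide_simps)
  have \<rho>1: "1 < \<rho>" unfolding \<rho>[symmetric] using q by (simp add: divide_simps) (simp add: algebra_simps)
  have ex: "\<rho> / (\<rho> - 1) = nh * (q - 1) / (2 * q - nh)"
  proof -
    have "\<rho> = nh * (q - 1) / ((nh - 2) * q)" using \<rho> by simp
    moreover have "\<rho> - 1 = (2 * q - nh) / ((nh - 2) * q)"
      unfolding \<open>\<rho> = nh * (q - 1) / ((nh - 2) * q)\<close> using q by (simp add: divide_simps) (simp add: algebra_simps)
    ultimately show ?thesis using q by simp
  qed
  have S0: "0 \<le> S" using \<tau> CP by (simp add: S_def)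
  \<comment> \<open>\<open>T\<close> dominates both Sobolev constants: the one for the test powers,
    up to the factor 2\<tau>, and the one for the potential of order q(p - 1).\<close>
  have T: "2 * (1 + CP) \<le> T" "4 * (q * (p - 1)) * (1 + CP) \<le> T"
  proof -
    have "4 * ((q * (p - 1)) * (1 + CP)) \<le> 2 * C_S 2 * ((q * (p - 1)) * (1 + CP))"
      using C_S_2_ge CP q by (intro mult_right_mono) auto
    then show "4 * (q * (p - 1)) * (1 + CP) \<le> T" by (simp add: T_def algebra_simps)
    moreover have "2 * (1 + CP) \<le> 4 * (q * (p - 1)) * (1 + CP)"
      using q CP by (intro mult_right_mono) auto
    ultimately show "2 * (1 + CP) \<le> T" by simp
  qed
  have T0: "0 < T" using T(1) CP by simp
  have A: "A \<le> T * ?D" unfolding A_def using T normD_nonneg by (intro mult_right_mono) auto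
  have A0: "0 \<le> A" unfolding A_def using q CP normD_nonneg by simp
  have sob: "normLp \<tau> v \<le> S * normD n a b h v" if "vanishing v" for v
    using sobolev_2d[OF n that CP poinc[OF that] \<tau>] by (simp add: S_def)
  have "normLp (q * (p - 1)) u \<le> A"
    using sobolev_2d[OF n u CP poinc[OF u], of "q * (p - 1)"] q by (simp add: A_def)
  from potential_bound[OF p1 q(1) _ this]
  have pot: "(\<Sum>x\<in>B. \<bar>u x\<bar> powr (p - 1 + 2 * \<beta>) * H)
      \<le> A powr (p - 1) * normLp (2 / (1 - s) * \<beta>) u powr (2 * \<beta>)" if "1 \<le> \<beta>" for \<beta>
    using that by (simp add: s_def)
  let ?R = "C2 * ?D powr (p - 1) + ?V powr s"
  have R0: "0 \<le> ?R" using C2 by simp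
  \<comment> \<open>One \<open>T\<close> comes from \<open>S\<close> and the power (p - 1)/2 from
    the root, together (p + 1)/2. As \<open>T \<ge> 1\<close>, the volume term may also be
    multiplied by \<open>T powr (p - 1)\<close>.\<close>
  have "S * sqrt (C2 * A powr (p - 1) + ?V powr s) \<le> 2 * \<tau> * T * (T powr ((p - 1) / 2) * sqrt ?R)"
  proof (rule mult_mono)
    show "S \<le> 2 * \<tau> * T" using mult_left_mono[OF T(1), of "2 * \<tau>"] \<tau> by (simp add: S_def mult_ac)
    have "A powr (p - 1) \<le> (T * ?D) powr (p - 1)" using A A0 p by (intro powr_mono2) auto
    then have "C2 * A powr (p - 1) \<le> C2 * (T powr (p - 1) * ?D powr (p - 1))"
      using C2 by (simp add: powr_mult)
    moreover have "?V powr s \<le> T powr (p - 1) * ?V powr s"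
      using ge_one_powr_ge_zero[of T "p - 1"] T(1) CP p by (simp add: mult_le_cancel_right1)
    ultimately have "C2 * A powr (p - 1) + ?V powr s \<le> T powr (p - 1) * ?R"
      by (simp add: algebra_simps)
    then have "sqrt (C2 * A powr (p - 1) + ?V powr s) \<le> sqrt (T powr (p - 1) * ?R)" by simp
    also have "\<dots> = T powr ((p - 1) / 2) * sqrt ?R"
      by (simp add: real_sqrt_mult powr_half_sqrt[symmetric] powr_powr)
    finally show "sqrt (C2 * A powr (p - 1) + ?V powr s) \<le> T powr ((p - 1) / 2) * sqrt ?R" .
  qed (use \<tau> T0 C2 in auto)
  also have "\<dots> = 4 * nh / (nh - 2) * T powr ((p + 1) / 2) * sqrt ?R"
  proof -
    have e: "(p + 1) / 2 = 1 + (p - 1) / 2" by (simp add: field_simps)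
    have "T powr ((p + 1) / 2) = T * T powr ((p - 1) / 2)"
      unfolding e powr_add using T0 by simp
    then show ?thesis by (simp add: \<tau>_def)
  qed
  finally have "max \<rho> (S * sqrt (C2 * A powr (p - 1) + ?V powr s))
      \<le> max \<rho> (4 * nh / (nh - 2) * T powr ((p + 1) / 2) * sqrt ?R)" by simp
  then have K: "max (\<tau> * (1 - s) / 2) (S * sqrt (C2 * A powr (p - 1) + ?V powr s))
      powr ((\<tau> * (1 - s) / 2 / (\<tau> * (1 - s) / 2 - 1))\<^sup>2) \<le> K"
    unfolding K_def K2_def Let_def \<rho> ex[symmetric] T_def[symmetric] s_def[symmetric] \<rho>_def[symmetric]
    using \<rho>1 by (intro powr_mono2) auto
  show ?thesis
    using sup_bound[OF u s(1,2) \<rho>1[unfolded \<rho>_def] C2 C3 S0 _ lap sob pot K poinc[OF u]]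
    unfolding s(3) by simp
qed

end

theorem mainTheorem14:
  fixes n :: nat and a b h :: "nat \<Rightarrow> real" and p C2 C3 CP q nh :: real
    and f :: "(nat \<Rightarrow> real) \<Rightarrow> real \<Rightarrow> real" and u :: "(nat \<Rightarrow> real) \<Rightarrow> real"
  assumes n2: "n \<ge> 2"
    and mesh: "admissible_mesh n a b h"
    and p1: "1 \<le> p"
    and p3: "n \<ge> 3 \<Longrightarrow> p < (real n + 2) / (real n - 2)"
    and q2: "n = 2 \<Longrightarrow> q > 1 \<and> q * (p - 1) > 2 \<and> q > nh / 2 \<and> nh / 2 > 1"
    and C2: "C2 > 0" and C3: "C3 > 0"
    and growth: "\<And>x s. x \<in> Omega_h n a b h \<Longrightarrow> \<bar>f x s\<bar> \<le> C2 * \<bar>s\<bar> powr p + C3"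
    and poincare: "\<And>v. v \<in> W0 n a b h \<Longrightarrow> normL2 n a b h v \<le> CP * normD n a b h v"
    and uW0: "u \<in> W0 n a b h"
    and eq: "\<And>x. x \<in> Omega_h n a b h \<Longrightarrow> - lap_h n h u x = f x (u x)"
  shows "(n \<ge> 3 \<longrightarrow>
           normInf n a b h u \<le>
             (2 * K3 n p C2 (normD n a b h u) (box_vol n a b)) powr (q3' n p) * CP * normD n a b h u
             + 2 * K3 n p C2 (normD n a b h u) (box_vol n a b) * C3 * (1 + box_vol n a b))
       \<and> (n = 2 \<longrightarrow>
           normInf n a b h u \<le>
             (2 * K2 q nh p C2 CP (normD n a b h u) (box_vol n a b)) powr (q / (q - 1)) * CP * normD n a b h u
             + 2 * K2 q nh p C2 CP (normD n a b h u) (box_vol n a b) * C3 * (1 + box_vol n a b))"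
proof -
  interpret box_mesh n a b h
    using n2 mesh by unfold_locales
  \<comment> \<open>The estimates need a function vanishing at every point outside \<open>W\<close>;
    \<open>zero_extension\<close> transfers the result back to \<open>u\<close>.\<close>
  define v where "v x = (if x \<in> W then u x else 0)" for x
  note ext = zero_extension[OF uW0, folded v_def]
  have lap: "\<bar>lap_h n h v x\<bar> \<le> C2 * \<bar>v x\<bar> powr p + C3" if x: "x \<in> W" for x
  proof -
    have "\<bar>lap_h n h v x\<bar> = \<bar>f x (u x)\<bar>"
      using eq[OF x] ext(5)[OF x] by linarith
    then show ?thesis using growth[OF x, of "u x"] x by (simp add: v_def)
  qed
  have W0: "w \<in> W0 n a b h" if "vanishing w" for w
    using that by (auto simp: W0_def vanishing_def simp flip: B_minus_W)
  have poinc: "normL2 n a b h w \<le> CP * normD n a b h w" if "vanishing w" for w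
    using poincare W0 that by blast
  have CP: "0 \<le> CP" using poincare_const_pos[OF poincare] by simp
  show ?thesis
  proof (intro conjI impI)
    assume n: "n \<ge> 3"
    show "normInf n a b h u \<le>
        (2 * K3 n p C2 (normD n a b h u) (box_vol n a b)) powr (q3' n p) * CP * normD n a b h u
        + 2 * K3 n p C2 (normD n a b h u) (box_vol n a b) * C3 * (1 + box_vol n a b)"
      using sup_bound_dim_ge_3[OF n p1 p3[OF n] C2 C3 ext(1) lap poinc[OF ext(1)]]
      unfolding ext(2,4) by (simp add: mult.assoc)
  next
    assume n: "n = 2"
    note qs = q2[OF n]
    show "normInf n a b h u \<le>
        (2 * K2 q nh p C2 CP (normD n a b h u) (box_vol n a b)) powr (q / (q - 1)) * CP * normD n a b h u
        + 2 * K2 q nh p C2 CP (normD n a b h u) (box_vol n a b) * C3 * (1 + box_vol n a b)"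
      using sup_bound_dim_2[OF n p1 _ _ _ _ C2 C3 ext(1) lap CP poinc, of q nh] qs
      unfolding ext(2,4) by (simp add: mult.assoc)
  qed
qed

end
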